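(* Let $P(\alpha,\beta)=\sum_{i=0}^k\alpha^i\beta^{k-i}B_i\in\mathbb{C}[\alpha,\beta]_k^{n\times n}$ be a regular homogeneous matrix polynomial and let $A\in GL(2,\mathbb{C})$. Let $(\alpha_0,\beta_0)$ be a simple eigenvalue of $P(\alpha,\beta)$ and let $\langle A^{-1}[\alpha_0,\beta_0]^T\rangle$ be the eigenvalue of $M_A(P)(\gamma,\delta)=\sum_{i=0}^k\gamma^i\delta^{k-i}\widetilde B_i$ associated with $(\alpha_0,\beta_0)$. Let $$Q_\theta^r:=\frac{\kappa_\theta^r(\langle A^{-1}[\alpha_0,\beta_0]^T\rangle,M_A(P))}{\kappa_\theta^r((\alpha_0,\beta_0),P)}$$ and let $Z_k:=4(k+1)^2\binom{k}{\lfloor k/2\rfloor}$. Assume that $B_0\ne0$, $B_k\ne0$, $\widetilde B_0\ne0$ and $\widetilde B_k\neq0$, and define $$\rho:=\frac{\max_{i=0:k}\{\|B_i\|_2\}}{\min\{\|B_0\|_2,\|B_k\|_2\}},\qquad \widetilde\rho:=\frac{\max_{i=0:k}\{\|\widetilde B_i\|_2\}}{\min\{\|\widetilde B_0\|_2,\|\widetilde B_k\|_2\}}.$$ 1. If $k=1$, then $$\frac{1}{4\,\mathrm{cond}_\infty(A)\,\widetilde\rho}\le Q_\theta^r\le 4\,\mathrm{cond}_\infty(A)\,\rho.$$ 2. If $k\ge2$, then $$\frac{1}{Z_k\,\mathrm{cond}_\infty(A)^{k-1}\,\widetilde\rho}\le Q_\theta^r\le Z_k\,\mathrm{cond}_\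infty(A)^{k-1}\,\rho.$$
   Context: $\mathbb{C}[\alpha,\beta]_k^{m\times n}$ is the space of homogeneous matrix polynomials $P(\alpha,\beta)=\sum_{i=0}^k\alpha^i\beta^{k-i}B_i$ with $B_i\in\mathbb{C}^{m\times n}$ (including the zero polynomial). For $m=n$, $P$ is regular if $\det P(\alpha,\beta)\not\equiv 0$. An eigenvalue of a regular $P$ is a line $(\alpha_0,\beta_0)=\langle[\alpha_0,\beta_0]^T\rangle$ through the origin in $\mathbb{C}^2$ spanned by a nonzero vector $[\alpha_0,\beta_0]^T$ with $\det P(\alpha_0,\beta_0)=0$; any such nonzero vector on the line is a representative. It is simple if its algebraic multiplicity (as a root of the homogeneous polynomial $\det P(\alpha,\beta)$) is 1. Nonzero vectors $x,y$ with $P(\alpha_0,\beta_0)x=0$, $y^*P(\alpha_0,\beta_0)=0$ are right and left eigenvectors. $\langle v\rangle$ denotes the line spanned by $v$. For $A=\begin{bmatrix}a&b\\c&d\end{bmatrix}\in GL(2,\mathbb{C})$ (nonsingular $2\times2$ complex matrices), the Möbius transform of $P$ is $M_A(P)(\gamma,\delta)=\sum_{i=0}^k(a\gamma+b\delta)^i(c\gamma+d\delta)^{k-i}B_i$, and $\widetilde B_i$ denotes its coefficient of $\gamma^i\delta^{k-i}$. If $P$ is regular, so is $M_A(P)$; if $(\alpha_0,\beta_0)$ is a simple eigenvalue of $P$, then $\langle A^{-1}[\alpha_0,\beta_0]^T\rangle$ is a simple eigenvalue of $M_A(P)$ with the same right and left eigenvectors, called the eigenvalue of $M_A(P)$ associated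 with $(\alpha_0,\beta_0)$. Stewart–Sun eigenvalue condition number. For nonnegative weights $\omega_i$, $\kappa_\theta((\alpha_0,\beta_0),P)$ is the limit as $\epsilon\to0$ of the supremum of $\chi((\alpha_0,\beta_0),(\alpha_0+\Delta\alpha_0,\beta_0+\Delta\beta_0))/\epsilon$ over perturbed eigenpairs, $[(P+\Delta P)(\alpha_0+\Delta\alpha_0,\beta_0+\Delta\beta_0)](x+\Delta x)=0$, $\Delta P=\sum_i\alpha^i\beta^{k-i}\Delta B_i$ with $\|\Delta B_i\|_2\le\epsilon\,\omega_i$, where $\chi$ is the chordal distance (sine of the angle between lines). It is given (known formula, which may be taken as the definition, independent of the representative and eigenvectors chosen) by $$\kappa_\theta((\alpha_0,\beta_0),P)=\Big(\sum_{i=0}^k|\alpha_0|^i|\beta_0|^{k-i}\omega_i\Big)\frac{\|y\|_2\|x\|_2}{|y^*(\overline{\beta_0}D_\alpha P(\alpha_0,\beta_0)-\overline{\alpha_0}D_\beta P(\alpha_0,\beta_0))x|},$$ with $x,y$ right and left eigenvectors and $D_\alpha,D_\beta$ partial derivatives. $\kappa_\theta^r$ denotes the choice $\omega_i=\|B_i\|_2$, $i=0:k$; for $M_A(P)$, accordingly, the weights are $\|\widetilde B_i\|_2$, $i=0:k$. $\|\cdot\|_2$ is the Euclidean/spectral norm, $\|A\|_\infty$ the maximum absolute row sum, and $\mathrm{cond}_\infty(A)=\|A\|_\infty\|A^{-1}\|_\infty$. *)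

theory Defs
  imports "HOL-Analysis.Analysis" "HOL-Computational_Algebra.Polynomial_Factorial"
    "HOL-Computational_Algebra.Field_as_Ring"
begin

text \<open>
  A homogeneous matrix polynomial of degree \<open>k\<close> is represented by \<open>k\<close> together with a coefficient
  function \<open>B\<close>, of which only \<open>B 0, \<dots>, B k\<close> are used; \<open>B i\<close> is the coefficient of
  \<open>\<alpha>\<^sup>i \<beta>\<^sup>k\<^sup>-\<^sup>i\<close>. Points \<open>(\<alpha>, \<beta>)\<close> are vectors \<open>v :: complex^2\<close> with \<open>\<alpha> = v$1\<close>, \<open>\<beta> = v$2\<close>.
\<close>

definition mscale :: "complex \<Rightarrow> complex^'n^'m \<Rightarrow> complex^'n^'m" (infixl "*m" 70) where
  "c *m M = (\<chi> i j. c * M$i$j)"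

definition hmp_eval :: "nat \<Rightarrow> (nat \<Rightarrow> complex^'n^'m) \<Rightarrow> complex^2 \<Rightarrow> complex^'n^'m" where
  "hmp_eval k B v = (\<Sum>i\<le>k. ((v$1)^i * (v$2)^(k - i)) *m B i)"

definition hmp_regular :: "nat \<Rightarrow> (nat \<Rightarrow> complex^'n^'n) \<Rightarrow> bool" where
  "hmp_regular k B \<longleftrightarrow> (\<exists>v. det (hmp_eval k B v) \<noteq> 0)"

definition hmp_D\<alpha> :: "nat \<Rightarrow> (nat \<Rightarrow> complex^'n^'m) \<Rightarrow> complex^2 \<Rightarrow> complex^'n^'m" where
  "hmp_D\<alpha> k B v = (\<Sum>i\<le>k. (of_nat i * (v$1)^(i - 1) * (v$2)^(k - i)) *m B i)"

definition hmp_D\<beta> :: "nat \<Rightarrow> (nat \<Rightarrow> complex^'n^'m) \<Rightarrow> complex^2 \<Rightarrow> complex^'n^'m" where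
  "hmp_D\<beta> k B v = (\<Sum>i\<le>k. ((v$1)^i * (of_nat (k - i) * (v$2)^(k - i - 1))) *m B i)"

lemma hmp_D\<alpha>_deriv:
  "((\<lambda>a. hmp_eval k B (vector [a, v$2]) $ r $ c) has_field_derivative hmp_D\<alpha> k B v $ r $ c) (at (v$1))"
  unfolding hmp_eval_def hmp_D\<alpha>_def mscale_def sum_component vec_lambda_beta vector_2
  by (auto intro!: derivative_eq_intros sum.cong)

lemma hmp_D\<beta>_deriv:
  "((\<lambda>b. hmp_eval k B (vector [v$1, b]) $ r $ c) has_field_derivative hmp_D\<beta> k B v $ r $ c) (at (v$2))"
  unfolding hmp_eval_def hmp_D\<beta>_def mscale_def sum_component vec_lambda_beta vector_2
  by (auto intro!: derivative_eq_intros sum.cong)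


text \<open>
  The formal determinant \<open>det P(\<alpha>, \<beta>)\<close> as an element of \<open>\<complex>[\<beta>][\<alpha>]\<close>: the variable \<open>\<alpha>\<close> is the
  outer one.
\<close>

definition hmp_det :: "nat \<Rightarrow> (nat \<Rightarrow> complex^'n^'n) \<Rightarrow> complex poly poly" where
  "hmp_det k B = det (\<chi> r c. \<Sum>i\<le>k. monom (monom (B i $ r $ c) (k - i)) i)"

lemma poly_hmp_det: "poly (poly (hmp_det k B) [:v$1:]) (v$2) = det (hmp_eval k B v)"
  unfolding hmp_det_def det_def hmp_eval_def mscale_def
  by (simp add: poly_sum poly_prod poly_monom poly_power mult_ac flip: poly_const_pow)

text \<open>
  The linear form \<open>\<beta>\<^sub>0 \<alpha> - \<alpha>\<^sub>0 \<beta>\<close> vanishing on the line through \<open>v = (\<alpha>\<^sub>0, \<beta>\<^sub>0)\<close>. Its multiplicity as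
  a factor of \<open>det P\<close> is the algebraic multiplicity of that line.
\<close>

definition linear_form :: "complex^2 \<Rightarrow> complex poly poly" where
  "linear_form v = monom [:v$2:] 1 - [:monom (v$1) 1:]"

definition line :: "complex^'n \<Rightarrow> (complex^'n) set" where
  "line v = vec.span {v}"

definition simple_eigenvalue :: "nat \<Rightarrow> (nat \<Rightarrow> complex^'n^'n) \<Rightarrow> (complex^2) set \<Rightarrow> bool" where
  "simple_eigenvalue k B L \<longleftrightarrow>
     (\<exists>v. v \<noteq> 0 \<and> L = line v \<and> det (hmp_eval k B v) = 0 \<and>
          multiplicity (linear_form v) (hmp_det k B) = 1)"


definition cnj_vec :: "complex^'n \<Rightarrow> complex^'n" where
  "cnj_vec y = (\<chi> i. cnj (y$i))"

definition right_eigenvector :: "nat \<Rightarrow> (nat \<Rightarrow> complex^'n^'n) \<Rightarrow> complex^2 \<Rightarrow> complex^'n \<Rightarrow> bool" where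
  "right_eigenvector k B v x \<longleftrightarrow> x \<noteq> 0 \<and> hmp_eval k B v *v x = 0"

definition left_eigenvector :: "nat \<Rightarrow> (nat \<Rightarrow> complex^'n^'n) \<Rightarrow> complex^2 \<Rightarrow> complex^'n \<Rightarrow> bool" where
  "left_eigenvector k B v y \<longleftrightarrow> y \<noteq> 0 \<and> cnj_vec y v* hmp_eval k B v = 0"

definition stewart_sun_value ::
  "nat \<Rightarrow> (nat \<Rightarrow> complex^'n^'n) \<Rightarrow> (nat \<Rightarrow> real) \<Rightarrow> complex^2 \<Rightarrow> complex^'n \<Rightarrow> complex^'n \<Rightarrow> real" where
  "stewart_sun_value k B \<omega> v x y =
     (\<Sum>i\<le>k. norm (v$1)^i * norm (v$2)^(k - i) * \<omega> i) *
     (norm y * norm x /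
      norm (scalar_product (cnj_vec y)
        ((cnj (v$2) *m hmp_D\<alpha> k B v - cnj (v$1) *m hmp_D\<beta> k B v) *v x)))"

text \<open>
  For a simple eigenvalue \<open>L\<close> the value does not depend on the representative \<open>v\<close> of \<open>L\<close> nor on the
  eigenvectors, so the definite description below denotes this common value.
\<close>

definition kappa_theta ::
  "nat \<Rightarrow> (nat \<Rightarrow> complex^'n^'n) \<Rightarrow> (nat \<Rightarrow> real) \<Rightarrow> (complex^2) set \<Rightarrow> real" where
  "kappa_theta k B \<omega> L =
     (THE r. \<exists>v x y. v \<noteq> 0 \<and> L = line v \<and> right_eigenvector k B v x \<and> left_eigenvector k B v y \<and>
                     r = stewart_sun_value k B \<omega> v x y)"

text \<open>
  The type class norm on \<open>complex^'n^'m\<close> is the Frobenius norm, whereas the norm on \<open>complex^'n\<close> is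
  the Euclidean one; hence the spectral norm is an operator norm.
\<close>

definition spectral_norm :: "complex^'n^'m \<Rightarrow> real" where
  "spectral_norm M = onorm (\<lambda>x. M *v x)"

definition kappa_theta_r :: "nat \<Rightarrow> (nat \<Rightarrow> complex^'n^'n) \<Rightarrow> (complex^2) set \<Rightarrow> real" where
  "kappa_theta_r k B L = kappa_theta k B (\<lambda>i. spectral_norm (B i)) L"


text \<open>
  The coefficient of \<open>\<gamma>\<^sup>l \<delta>\<^sup>k\<^sup>-\<^sup>l\<close> in \<open>(a\<gamma> + b\<delta>)\<^sup>i (c\<gamma> + d\<delta>)\<^sup>k\<^sup>-\<^sup>i\<close> is read off after setting
  \<open>\<delta> = 1\<close>.
\<close>

definition moebius_coeff :: "nat \<Rightarrow> complex^2^2 \<Rightarrow> (nat \<Rightarrow> complex^'n^'m) \<Rightarrow> nat \<Rightarrow> complex^'n^'m" where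
  "moebius_coeff k A B l =
     (\<Sum>i\<le>k. coeff ([:A$1$2, A$1$1:]^i * [:A$2$2, A$2$1:]^(k - i)) l *m B i)"

lemma homogenize_linear_mult:
  fixes p :: "complex poly"
  assumes "degree p \<le> n"
  shows "(\<Sum>l\<le>Suc n. x^l * y^(Suc n - l) * coeff ([:b, a:] * p) l) =
         (a * x + b * y) * (\<Sum>l\<le>n. x^l * y^(n - l) * coeff p l)"
proof -
  have z: "coeff p (Suc n) = 0" using assms by (simp add: coeff_eq_0)
  have "(\<Sum>l\<le>Suc n. x^l * y^(Suc n - l) * coeff ([:b, a:] * p) l) =
        b * (\<Sum>l\<le>Suc n. x^l * y^(Suc n - l) * coeff p l) +
        (\<Sum>l\<le>Suc n. x^l * y^(Suc n - l) * coeff (pCons 0 (smult a p)) l)"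
    unfolding sum_distrib_left by (simp add: algebra_simps sum.distrib)
  also have "(\<Sum>l\<le>Suc n. x^l * y^(Suc n - l) * coeff (pCons 0 (smult a p)) l) =
        a * x * (\<Sum>l\<le>n. x^l * y^(n - l) * coeff p l)"
    unfolding sum.atMost_Suc_shift sum_distrib_left by (simp add: algebra_simps)
  also have "(\<Sum>l\<le>Suc n. x^l * y^(Suc n - l) * coeff p l) =
        y * (\<Sum>l\<le>n. x^l * y^(n - l) * coeff p l)"
    unfolding sum.atMost_Suc sum_distrib_left by (simp add: z Suc_diff_le algebra_simps)
  finally show ?thesis by (simp add: algebra_simps)
qed

lemma homogenize_linear_power_mult:
  fixes p :: "complex poly"
  assumes "degree p \<le> n"
  shows "degree ([:b, a:]^m * p) \<le> m + n \<and>
         (\<Sum>l\<le>m + n. x^l * y^(m + n - l) * coeff ([:b, a:]^m * p) l) =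
         (a * x + b * y)^m * (\<Sum>l\<le>n. x^l * y^(n - l) * coeff p l)"
proof (induction m)
  case (Suc m)
  let ?q = "[:b, a:]^m * p"
  have eq: "[:b, a:]^Suc m * p = [:b, a:] * ?q" by (simp only: power_Suc mult.assoc)
  have "degree ([:b, a:] * ?q) \<le> degree [:b, a:] + degree ?q" by (rule degree_mult_le)
  also have "\<dots> \<le> 1 + (m + n)"
    using Suc.IH by (intro add_mono) (simp_all only: degree_pCons_eq_if, simp)
  also have "\<dots> = Suc m + n" by simp
  finally have "degree ([:b, a:]^Suc m * p) \<le> Suc m + n" unfolding eq .
  moreover have "(\<Sum>l\<le>Suc (m + n). x^l * y^(Suc (m + n) - l) * coeff ([:b, a:] * ?q) l) =
      (a * x + b * y) * ((a * x + b * y)^m * (\<Sum>l\<le>n. x^l * y^(n - l) * coeff p l))"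
    using homogenize_linear_mult[of ?q "m + n" x y b a] Suc.IH by simp
  ultimately show ?case unfolding eq by (simp only: add_Suc power_Suc mult.assoc)
qed (use assms in simp)

lemma hmp_eval_moebius: "hmp_eval k (moebius_coeff k A B) w = hmp_eval k B (A *v w)"
proof -
  define f where "f i l = coeff ([:A$1$2, A$1$1:]^i * [:A$2$2, A$2$1:]^(k - i)) l" for i l
  have Av: "(A *v w)$1 = A$1$1 * w$1 + A$1$2 * w$2" "(A *v w)$2 = A$2$1 * w$1 + A$2$2 * w$2"
    by (simp_all add: matrix_vector_mult_def sum_2)
  have f: "(\<Sum>l\<le>k. (w$1)^l * (w$2)^(k - l) * f i l) = ((A *v w)$1)^i * ((A *v w)$2)^(k - i)"
    if "i \<le> k" for i
  proof -
    note h = homogenize_linear_power_mult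
    have 1: "degree ([:A$2$2, A$2$1:]^(k - i)) \<le> k - i"
      using h[of "1" 0 "A$2$2" "A$2$1" "k - i"] by (simp only: mult_1_right degree_1 add_0_right)
    have 2: "(\<Sum>l\<le>k - i. (w$1)^l * (w$2)^(k - i - l) * coeff ([:A$2$2, A$2$1:]^(k - i)) l) =
             (A$2$1 * w$1 + A$2$2 * w$2)^(k - i)"
      using h[of "1" 0 "A$2$2" "A$2$1" "k - i" "w$1" "w$2"]
      unfolding mult_1_right degree_1 add_0_right by simp
    have "i + (k - i) = k" using that by simp
    with h[OF 1, of "A$1$2" "A$1$1" i "w$1" "w$2"] show ?thesis
      unfolding f_def Av 2 by metis
  qed
  have "hmp_eval k (moebius_coeff k A B) w $ r $ c = hmp_eval k B (A *v w) $ r $ c" for r c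
  proof -
    have "hmp_eval k (moebius_coeff k A B) w $ r $ c =
      (\<Sum>l\<le>k. \<Sum>i\<le>k. (w$1)^l * (w$2)^(k - l) * f i l * B i $ r $ c)"
      unfolding hmp_eval_def moebius_coeff_def mscale_def f_def[symmetric]
        sum_component vec_lambda_beta sum_distrib_left mult.assoc ..
    also have "\<dots> = (\<Sum>i\<le>k. (\<Sum>l\<le>k. (w$1)^l * (w$2)^(k - l) * f i l) * B i $ r $ c)"
      unfolding sum_distrib_right by (rule sum.swap)
    also have "\<dots> = (\<Sum>i\<le>k. ((A *v w)$1)^i * ((A *v w)$2)^(k - i) * B i $ r $ c)"
      by (rule sum.cong[OF refl]) (simp only: f atMost_iff)
    also have "\<dots> = hmp_eval k B (A *v w) $ r $ c"
      unfolding hmp_eval_def mscale_def sum_component vec_lambda_beta ..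
    finally show ?thesis .
  qed
  then show ?thesis by (simp add: vec_eq_iff)
qed

definition norm_inf :: "complex^'n^'m \<Rightarrow> real" where
  "norm_inf M = Max (range (\<lambda>i. \<Sum>j\<in>UNIV. norm (M$i$j)))"

definition cond_inf :: "complex^'n^'n \<Rightarrow> real" where
  "cond_inf M = norm_inf M * norm_inf (matrix_inv M)"

definition coeff_ratio :: "nat \<Rightarrow> (nat \<Rightarrow> complex^'n^'m) \<Rightarrow> real" where
  "coeff_ratio k B =
     Max ((\<lambda>i. spectral_norm (B i)) ` {0..k}) / min (spectral_norm (B 0)) (spectral_norm (B k))"

definition Q_theta_r ::
  "nat \<Rightarrow> complex^2^2 \<Rightarrow> (nat \<Rightarrow> complex^'n^'n) \<Rightarrow> complex^2 \<Rightarrow> real" where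
  "Q_theta_r k A B v =
     kappa_theta_r k (moebius_coeff k A B) (line (matrix_inv A *v v)) / kappa_theta_r k B (line v)"

definition Z_const :: "nat \<Rightarrow> real" where
  "Z_const k = 4 * (real k + 1)^2 * real (k choose (k div 2))"

end

theory Submission
  imports Defs
begin

text \<open>
  Write \<open>v = A w\<close>. By Euler's identity, \<open>u \<mapsto> y\<^sup>* P'(v)[u] x\<close> is a multiple \<open>\<mu>\<close> of the linear form
  \<open>v$2 u$1 - v$1 u$2\<close>, and the denominator of the condition number is \<open>|\<mu>| |v|\<^sup>2\<close>. Passing to
  \<open>M\<^sub>A(P)\<close> at \<open>w\<close> multiplies \<open>\<mu>\<close> by \<open>det A\<close>, so with the sums \<open>N(P, v) = \<Sum>\<^sub>i |\<alpha>\<^sub>0|\<^sup>i |\<beta>\<^sub>0|\<^sup>k\<^sup>-\<^sup>i \<parallel>B\<^sub>i\<parallel>\<close>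
  the quotient is \<open>Q = N(M\<^sub>A(P), w) |v|\<^sup>2 / (|det A| |w|\<^sup>2 N(P, v))\<close>. The upper bound follows by estimating
  the numerator in terms of the maximal and the denominator in terms of the extreme coefficients of
  \<open>P\<close>; the lower bound is the same estimate for \<open>M\<^sub>A(P)\<close> and \<open>A\<^sup>-\<^sup>1\<close>. That \<open>\<mu> \<noteq> 0\<close> at a simple
  eigenvalue holds because otherwise \<open>det P\<close> would vanish to second order along the line.
\<close>

section \<open>Directional derivatives and the eigenvector pairing\<close>

definition bil :: "complex^'m \<Rightarrow> complex^'n^'m \<Rightarrow> complex^'n \<Rightarrow> complex" where
  "bil y M x = scalar_product (cnj_vec y) (M *v x)"

text \<open>The derivative \<open>P'(v)[u]\<close>. Keeping the direction \<open>u\<close> free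
  makes the chain rule and Euler's identity available.\<close>

definition hmp_dir :: "nat \<Rightarrow> (nat \<Rightarrow> complex^'n^'m) \<Rightarrow> complex^2 \<Rightarrow> complex^2 \<Rightarrow> complex^'n^'m" where
  "hmp_dir k B v u = u$1 *m hmp_D\<alpha> k B v + u$2 *m hmp_D\<beta> k B v"

text \<open>Orthogonal to \<open>v\<close> in the Hermitian inner product. In this direction
  \<open>hmp_dir\<close> is the matrix in the denominator of the condition number, and the form
  \<open>v$2 u$1 - v$1 u$2\<close> takes the value \<open>|v|^2\<close>.\<close>

definition perp :: "complex^2 \<Rightarrow> complex^2" where
  "perp v = vector [cnj (v$2), - cnj (v$1)]"

lemma perp_component [simp]: "perp v $ 1 = cnj (v$2)" "perp v $ 2 = - cnj (v$1)"
  by (simp_all add: perp_def)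

lemma bil_expand: "bil y M x = (\<Sum>i\<in>UNIV. \<Sum>j\<in>UNIV. cnj (y$i) * M$i$j * x$j)"
  by (simp add: bil_def scalar_product_def cnj_vec_def matrix_vector_mult_def sum_distrib_left mult_ac)

lemma bil_add: "bil y (M + N) x = bil y M x + bil y N x"
  by (simp add: bil_expand algebra_simps sum.distrib)

lemma bil_mscale: "bil y (c *m M) x = c * bil y M x"
  by (simp add: bil_expand mscale_def sum_distrib_left mult_ac)

lemma bil_vec_right: "bil y M (a *s x + b *s z) = a * bil y M x + b * bil y M z"
  by (simp add: bil_expand algebra_simps sum.distrib sum_distrib_left)

lemma bil_scale_right: "bil y M (a *s x) = a * bil y M x"
  by (simp add: bil_expand sum_distrib_left mult_ac)

lemma bil_scale_left: "bil (a *s y) M x = cnj a * bil y M x"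
  by (simp add: bil_expand sum_distrib_left mult_ac)

lemma bil_vec_left: "bil (a *s y + b *s z) M x = cnj a * bil y M x + cnj b * bil z M x"
  by (simp add: bil_expand algebra_simps sum.distrib sum_distrib_left)

lemma bil_hmp_dir:
  "bil y (hmp_dir k B v u) x = u$1 * bil y (hmp_D\<alpha> k B v) x + u$2 * bil y (hmp_D\<beta> k B v) x"
  by (simp add: hmp_dir_def bil_add bil_mscale)

lemma stewart_sun_value_bil:
  "stewart_sun_value k B \<omega> v x y =
     (\<Sum>i\<le>k. norm (v$1)^i * norm (v$2)^(k - i) * \<omega> i) *
     (norm y * norm x / norm (bil y (hmp_dir k B v (perp v)) x))"
proof -
  have "cnj (v$2) *m hmp_D\<alpha> k B v - cnj (v$1) *m hmp_D\<beta> k B v = hmp_dir k B v (perp v)"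
    by (simp add: hmp_dir_def mscale_def vec_eq_iff)
  then show ?thesis by (simp add: stewart_sun_value_def bil_def)
qed

lemma right_eigenvector_bil_0: "right_eigenvector k B v x \<Longrightarrow> bil y (hmp_eval k B v) x = 0"
  by (simp add: right_eigenvector_def bil_def scalar_product_def)

lemma sum_right_kernel:
  "right_eigenvector k B v x \<Longrightarrow> (\<Sum>j\<in>UNIV. hmp_eval k B v $ i $ j * x $ j) = 0"
  by (auto simp: right_eigenvector_def matrix_vector_mult_def vec_eq_iff)

lemma sum_left_kernel:
  "left_eigenvector k B v y \<Longrightarrow> (\<Sum>i\<in>UNIV. cnj (y $ i) * hmp_eval k B v $ i $ j) = 0"
  by (auto simp: left_eigenvector_def vector_matrix_mult_def cnj_vec_def vec_eq_iff mult_ac)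

section \<open>Homogeneity, chain rule and Euler's identity\<close>

lemma hmp_eval_component:
  "hmp_eval k B v $ r $ c = (\<Sum>i\<le>k. (v$1)^i * (v$2)^(k - i) * B i $ r $ c)"
  by (simp add: hmp_eval_def mscale_def)

lemma hmp_eval_scale: "hmp_eval k B (s *s v) = s^k *m hmp_eval k B v"
proof -
  have "(s * a)^i * (s * b)^(k - i) = s^k * (a^i * b^(k - i))" if "i \<le> k" for a b :: complex and i
    using that by (simp add: power_mult_distrib mult_ac flip: power_add)
  then show ?thesis
    by (simp add: vec_eq_iff hmp_eval_component mscale_def sum_distrib_left mult.assoc)
qed

lemma hmp_dir_deriv:
  "((\<lambda>t. hmp_eval k B (v + t *s u) $ r $ c) has_field_derivative hmp_dir k B v u $ r $ c) (at 0)"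
  unfolding hmp_eval_def hmp_dir_def hmp_D\<alpha>_def hmp_D\<beta>_def mscale_def sum_component vec_lambda_beta
    vector_add_component vector_smult_component sum_distrib_left sum.distrib[symmetric]
  by (auto intro!: derivative_eq_intros sum.cong simp: algebra_simps)

text \<open>Chain rule for the substitution \<open>v = A w\<close>: both sides are derivatives at
  \<open>t = 0\<close> of the same function of \<open>t\<close>.\<close>

lemma hmp_dir_moebius:
  "hmp_dir k (moebius_coeff k A B) w z = hmp_dir k B (A *v w) (A *v z)"
proof -
  have "hmp_eval k (moebius_coeff k A B) (w + t *s z) = hmp_eval k B (A *v w + t *s (A *v z))" for t
    by (simp add: hmp_eval_moebius matrix_vector_right_distrib vector_scalar_commute)
  then have "hmp_dir k (moebius_coeff k A B) w z $ r $ c = hmp_dir k B (A *v w) (A *v z) $ r $ c" for r c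
    using hmp_dir_deriv[of k "moebius_coeff k A B" w z r c]
      hmp_dir_deriv[of k B "A *v w" "A *v z" r c] DERIV_unique by fastforce
  then show ?thesis by (simp add: vec_eq_iff)
qed

text \<open>The derivative is homogeneous of degree \<open>k - 1\<close>; the factor
  \<open>s\<close> on the left avoids this exponent, which is wrong at \<open>k = 0\<close>.\<close>

lemma hmp_dir_scale:
  assumes "s \<noteq> 0"
  shows "s *m hmp_dir k B (s *s v) u = s^k *m hmp_dir k B v u"
proof -
  have "s * hmp_dir k B (s *s v) u $ r $ c = s^k * hmp_dir k B v u $ r $ c" for r c
  proof -
    \<comment> \<open>The direction \<open>s u\<close> instead of \<open>u\<close> turns the whole
      argument into \<open>s (v + t u)\<close>, so that homogeneity of \<open>P\<close>
      applies.\<close>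
    have "((\<lambda>t. hmp_eval k B (s *s v + t *s (s *s u)) $ r $ c) has_field_derivative
        s^k * hmp_dir k B v u $ r $ c) (at 0)"
    proof -
      have eq: "s *s v + t *s (s *s u) = s *s (v + t *s u)" for t
        by (simp add: vec_eq_iff algebra_simps)
      show ?thesis unfolding eq hmp_eval_scale mscale_def vec_lambda_beta
        by (intro DERIV_cmult hmp_dir_deriv)
    qed
    then have "hmp_dir k B (s *s v) (s *s u) $ r $ c = s^k * hmp_dir k B v u $ r $ c"
      using hmp_dir_deriv DERIV_unique by blast
    then show ?thesis by (simp add: hmp_dir_def mscale_def algebra_simps)
  qed
  then show ?thesis by (simp add: vec_eq_iff mscale_def)
qed

text \<open>Along \<open>v + t v = (1 + t) v\<close> homogeneity reduces the derivative to that of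
  \<open>(1 + t)^k\<close> at \<open>t = 0\<close>.\<close>

lemma hmp_dir_euler: "hmp_dir k B v v = of_nat k *m hmp_eval k B v"
proof -
  have "hmp_dir k B v v $ r $ c = of_nat k * hmp_eval k B v $ r $ c" for r c
  proof -
    have eq: "v + t *s v = (1 + t) *s v" for t by (simp add: vec_eq_iff algebra_simps)
    have "((\<lambda>t. (1 + t)^k * hmp_eval k B v $ r $ c) has_field_derivative
        of_nat k * hmp_eval k B v $ r $ c) (at 0)"
      by (auto intro!: derivative_eq_intros)
    then have "((\<lambda>t. hmp_eval k B (v + t *s v) $ r $ c) has_field_derivative
        of_nat k * hmp_eval k B v $ r $ c) (at 0)"
      unfolding eq hmp_eval_scale mscale_def vec_lambda_beta .
    then show ?thesis using hmp_dir_deriv DERIV_unique by blast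
  qed
  then show ?thesis by (simp add: vec_eq_iff mscale_def)
qed

lemma norm_vec2_sq: "complex_of_real ((norm (v::complex^2))\<^sup>2) = v$1 * cnj (v$1) + v$2 * cnj (v$2)"
  by (simp add: norm_vec_def L2_set_def sum_2 sum_nonneg flip: complex_norm_square)

text \<open>By Euler's identity the form \<open>u \<mapsto> y\<^sup>* P'(v)[u] x\<close> kills \<open>v\<close>, so it is a multiple of the
  form \<open>v$2 u$1 - v$1 u$2\<close>.\<close>

lemma bil_hmp_dir_line:
  assumes "right_eigenvector k B v x"
  shows "of_real ((norm v)\<^sup>2) * bil y (hmp_dir k B v u) x =
    (v$2 * u$1 - v$1 * u$2) * bil y (hmp_dir k B v (perp v)) x"
proof -
  have "bil y (hmp_dir k B v v) x = 0"
    using right_eigenvector_bil_0[OF assms] by (simp add: hmp_dir_euler bil_mscale)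
  then have e: "v$1 * bil y (hmp_D\<alpha> k B v) x + v$2 * bil y (hmp_D\<beta> k B v) x = 0"
    by (simp add: bil_hmp_dir)
  \<comment> \<open>The claim becomes a polynomial identity modulo
    \<open>v$1 * p + v$2 * q = 0\<close>, a relation saying that \<open>(p, q)\<close> is
    proportional to \<open>(v$2, - v$1)\<close>.\<close>
  define p q where "p = bil y (hmp_D\<alpha> k B v) x" and "q = bil y (hmp_D\<beta> k B v) x"
  have e': "v$1 * p + v$2 * q = 0" using e by (simp add: p_def q_def)
  show ?thesis unfolding bil_hmp_dir norm_vec2_sq perp_component p_def[symmetric] q_def[symmetric]
    using e' by algebra
qed

text \<open>The form \<open>v$2 u$1 - v$1 u$2\<close> is a determinant up to sign, so inserting
  \<open>A w\<close> and \<open>A (perp w)\<close> multiplies its value \<open>|w|^2\<close> at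
  \<open>w\<close>, \<open>perp w\<close> by \<open>det A\<close>.\<close>

lemma bil_moebius_perp:
  assumes "right_eigenvector k B (A *v w) x"
  shows "of_real ((norm (A *v w))\<^sup>2) * bil y (hmp_dir k (moebius_coeff k A B) w (perp w)) x =
    det A * of_real ((norm w)\<^sup>2) * bil y (hmp_dir k B (A *v w) (perp (A *v w))) x"
  unfolding hmp_dir_moebius bil_hmp_dir_line[OF assms]
  by (simp add: matrix_vector_mult_def sum_2 det_2 norm_vec2_sq del: of_real_power)
    (simp add: algebra_simps)

section \<open>Nondegeneracy at a simple eigenvalue\<close>

text \<open>In the Leibniz expansion each product either contains the entry at \<open>(a, b)\<close>
  or two different entries, one from row \<open>a\<close> and one from column
  \<open>b\<close>.\<close>

lemma square_dvd_det:
  fixes N :: "'a::comm_ring_1^'n^'n"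
  assumes row: "\<And>j. d dvd N$a$j" and col: "\<And>i. d dvd N$i$b" and cross: "d^2 dvd N$a$b"
  shows "d^2 dvd det N"
  unfolding det_def
proof (intro dvd_sum dvd_mult)
  fix p assume "p \<in> {p. p permutes (UNIV :: 'n set)}"
  then have p: "p permutes (UNIV :: 'n set)" by simp
  have split: "(\<Prod>i\<in>UNIV. N$i$p i) = N$a$p a * (\<Prod>i\<in>UNIV - {a}. N$i$p i)"
    using prod.remove[of UNIV a "\<lambda>i. N$i$p i"] by simp
  show "d^2 dvd (\<Prod>i\<in>UNIV. N$i$p i)"
  proof (cases "p a = b")
    case True
    then show ?thesis unfolding split using cross by (metis dvd_mult2)
  next
    case False
    \<comment> \<open>\<open>m\<close> is the row in which the permutation meets column
      \<open>b\<close>; it differs from \<open>a\<close> in this case.\<close>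
    obtain m where m: "p m = b" using permutes_surj[OF p] by (metis surjD)
    with False have "m \<in> UNIV - {a}" by auto
    then have "(\<Prod>i\<in>UNIV - {a}. N$i$p i) = N$m$p m * (\<Prod>i\<in>UNIV - {a} - {m}. N$i$p i)"
      using prod.remove[of "UNIV - {a}" m "\<lambda>i. N$i$p i"] by simp
    then have "(\<Prod>i\<in>UNIV. N$i$p i) = N$a$p a * N$m$b * (\<Prod>i\<in>UNIV - {a} - {m}. N$i$p i)"
      unfolding split by (simp only: m mult.assoc)
    moreover have "d^2 dvd N$a$p a * N$m$b"
      unfolding power2_eq_square by (rule mult_dvd_mono[OF row col])
    ultimately show ?thesis by (simp only: dvd_mult2)
  qed
qed

text \<open>Cramer's rule for the identity matrix. It certifies that the base changes built from
  eigenvectors below are invertible.\<close>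

lemma det_replace_column_mat1:
  fixes x :: "'a::field^'n"
  shows "det (\<chi> i j. if j = b then x$i else if i = j then 1 else 0) = x$b"
proof -
  have "(\<chi> i j. if j = b then x$i else if i = j then 1 else 0) =
      (\<chi> i j. if j = b then (mat 1 *v x)$i else (mat 1 :: 'a^'n^'n)$i$j)"
    unfolding matrix_vector_mul_lid by (simp add: vec_eq_iff mat_def)
  then show ?thesis by (simp only: cramer_lemma det_I mult_1_right)
qed

lemma det_replace_row_mat1:
  fixes y :: "'a::field^'n"
  shows "det (\<chi> i j. if i = a then y$j else if i = j then 1 else 0) = y$a"
proof -
  let ?R = "\<chi> i j. if i = a then y$j else if i = j then 1 else 0"
  have "transpose ?R = (\<chi> i j. if j = a then y$i else if i = j then 1 else 0)"
    by (simp add: transpose_def eq_commute cong: if_cong)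
  then have "det (transpose ?R) = y$a" by (simp only: det_replace_column_mat1)
  then show ?thesis by (simp only: det_transpose)
qed

text \<open>\<open>P(v + t u)\<close> as a matrix over \<open>\<complex>[t]\<close>.\<close>

definition line_mat :: "nat \<Rightarrow> (nat \<Rightarrow> complex^'n^'m) \<Rightarrow> complex^2 \<Rightarrow> complex^2 \<Rightarrow> complex poly^'n^'m" where
  "line_mat k B v u =
    (\<chi> r c. \<Sum>i\<le>k. [:v$1, u$1:]^i * [:v$2, u$2:]^(k - i) * [:B i $ r $ c:])"

lemma poly_line_mat: "poly (line_mat k B v u $ r $ c) t = hmp_eval k B (v + t *s u) $ r $ c"
  by (simp add: line_mat_def hmp_eval_component poly_sum poly_power algebra_simps)

lemma poly_det: "poly (det M) t = det (\<chi> r c. poly (M$r$c) t)"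
  by (simp add: det_def poly_sum poly_prod)

lemma poly_det_line_mat: "poly (det (line_mat k B v u)) t = det (hmp_eval k B (v + t *s u))"
  by (simp add: poly_det poly_line_mat)

lemma coeff_line_mat_0: "coeff (line_mat k B v u $ r $ c) 0 = hmp_eval k B v $ r $ c"
proof -
  have "coeff (line_mat k B v u $ r $ c) 0 = poly (line_mat k B v u $ r $ c) 0"
    by (rule poly_0_coeff_0[symmetric])
  then show ?thesis unfolding poly_line_mat by simp
qed

lemma coeff_line_mat_1: "coeff (line_mat k B v u $ r $ c) 1 = hmp_dir k B v u $ r $ c"
proof -
  have "poly (pderiv (line_mat k B v u $ r $ c)) 0 = hmp_dir k B v u $ r $ c"
    by (rule DERIV_unique[OF poly_DERIV]) (simp only: poly_line_mat hmp_dir_deriv)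
  then show ?thesis by (simp add: poly_0_coeff_0 coeff_pderiv)
qed

lemma degree_line_mat: "degree (line_mat k B v u $ r $ c) \<le> k"
  unfolding line_mat_def vec_lambda_beta
proof (rule degree_sum_le)
  fix i assume i: "i \<in> {..k}"
  have 1: "degree ([:a, b:]^m) \<le> m" for a b :: complex and m
  proof -
    have "degree ([:a, b:]^m) \<le> degree [:a, b:] * m" by (rule degree_power_le)
    also have "\<dots> \<le> 1 * m" by (rule mult_right_mono) (simp_all add: degree_pCons_eq_if)
    finally show ?thesis by simp
  qed
  have "degree ([:v$1, u$1:]^i * [:v$2, u$2:]^(k - i)) \<le>
      degree ([:v$1, u$1:]^i) + degree ([:v$2, u$2:]^(k - i))" by (rule degree_mult_le)
  also have "\<dots> \<le> i + (k - i)" by (rule add_mono) (rule 1)+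
  also have "\<dots> = k" using i by simp
  finally have "degree ([:v$1, u$1:]^i * [:v$2, u$2:]^(k - i)) \<le> k" .
  then show "degree ([:v$1, u$1:]^i * [:v$2, u$2:]^(k - i) * [:B i $ r $ c:]) \<le> k"
    using degree_mult_le[of "[:v$1, u$1:]^i * [:v$2, u$2:]^(k - i)" "[:B i $ r $ c:]"]
    unfolding degree_pCons_0 by linarith
qed simp

lemma degree_det_line_mat:
  "degree (det (line_mat k B v u :: complex poly^'n^'n)) \<le> k * CARD('n)"
  unfolding det_def
proof (rule degree_sum_le)
  fix p :: "'n \<Rightarrow> 'n"
  have "degree (\<Prod>i\<in>UNIV. line_mat k B v u $ i $ p i) \<le>
      sum (degree \<circ> (\<lambda>i. line_mat k B v u $ i $ p i)) UNIV"
    by (rule degree_prod_sum_le) simp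
  also have "\<dots> \<le> (\<Sum>i\<in>(UNIV :: 'n set). k)"
    by (rule sum_mono) (simp add: degree_line_mat)
  finally have "degree (\<Prod>i\<in>UNIV. line_mat k B v u $ i $ p i) \<le> k * CARD('n)"
    by (simp add: mult.commute)
  then show "degree (of_int (sign p) * (\<Prod>i\<in>UNIV. line_mat k B v u $ i $ p i)) \<le> k * CARD('n)"
    using degree_mult_le[of "of_int (sign p)" "\<Prod>i\<in>UNIV. line_mat k B v u $ i $ p i"] by simp
qed (simp add: finite_permutations)

text \<open>In bases of \<open>\<complex>\<^sup>n\<close> containing \<open>x\<close> and \<open>y\<close>, one row and one column of \<open>P(v + t u)\<close> vanish at
  \<open>t = 0\<close>, and their common entry vanishes to second order.\<close>

lemma square_dvd_det_line_mat:
  fixes B :: "nat \<Rightarrow> complex^'n^'n"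
  assumes x: "right_eigenvector k B v x" and y: "left_eigenvector k B v y"
    and 0: "bil y (hmp_dir k B v u) x = 0"
  shows "monom 1 2 dvd det (line_mat k B v u)"
proof -
  obtain a where a: "y$a \<noteq> 0" using y by (auto simp: left_eigenvector_def vec_eq_iff)
  obtain b where b: "x$b \<noteq> 0" using x by (auto simp: right_eigenvector_def vec_eq_iff)
  \<comment> \<open>\<open>S\<close> carries \<open>y^*\<close> as row \<open>a\<close> and
    \<open>T\<close> carries \<open>x\<close> as column \<open>b\<close>, so in
    \<open>N = S P(v + t u) T\<close> row \<open>a\<close> starts from \<open>y^* P\<close> and
    column \<open>b\<close> from \<open>P x\<close>. The choice of \<open>a\<close> and
    \<open>b\<close> makes both determinants nonzero.\<close>
  define S :: "complex^'n^'n" where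
    "S = (\<chi> i j. if i = a then cnj_vec y$j else if i = j then 1 else 0)"
  define T :: "complex^'n^'n" where
    "T = (\<chi> i j. if j = b then x$i else if i = j then 1 else 0)"
  define N :: "complex poly^'n^'n" where
    "N = (\<chi> i j. \<Sum>r\<in>UNIV. \<Sum>s\<in>UNIV. [:S$i$r:] * line_mat k B v u $ r $ s * [:T$s$j:])"
  have detST: "det S = cnj (y$a)" "det T = x$b"
    by (simp_all add: S_def T_def det_replace_row_mat1 det_replace_column_mat1 cnj_vec_def)
  \<comment> \<open>Multiplicativity of the determinant is used pointwise in \<open>t\<close>; over
    the complex numbers the values determine the polynomial.\<close>
  have "poly (det N) t = poly (smult (det S * det T) (det (line_mat k B v u))) t" for t
  proof -
    define M where "M = hmp_eval k B (v + t *s u)"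
    have "(S ** M ** T)$i$j = poly (N$i$j) t" for i j
    proof -
      have "(S ** M ** T)$i$j = (\<Sum>s\<in>UNIV. \<Sum>r\<in>UNIV. S$i$r * M$r$s * T$s$j)"
        by (simp add: matrix_matrix_mult_def sum_distrib_right)
      also have "\<dots> = (\<Sum>r\<in>UNIV. \<Sum>s\<in>UNIV. S$i$r * M$r$s * T$s$j)"
        by (rule sum.swap)
      also have "\<dots> = poly (N$i$j) t"
        by (simp add: N_def M_def poly_sum poly_line_mat mult_ac)
      finally show ?thesis .
    qed
    then have "(\<chi> r c. poly (N$r$c) t) = S ** M ** T" by (simp add: vec_eq_iff)
    then show ?thesis by (simp add: poly_det[of N] poly_det_line_mat det_mul M_def)
  qed
  then have detN: "det N = smult (cnj (y$a) * x$b) (det (line_mat k B v u))"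
    unfolding detST by (metis ext poly_eq_poly_eq_iff)
  have coeffN: "coeff (N$i$j) m =
      (\<Sum>r\<in>UNIV. \<Sum>s\<in>UNIV. S$i$r * coeff (line_mat k B v u $ r $ s) m * T$s$j)" for i j m
    by (simp add: N_def coeff_sum mult_ac)
  have "monom 1 1 dvd N$a$j" for j
  proof -
    have "coeff (N$a$j) 0 =
        (\<Sum>s\<in>UNIV. (\<Sum>r\<in>UNIV. cnj (y$r) * hmp_eval k B v $ r $ s) * T$s$j)"
      unfolding coeffN coeff_line_mat_0 sum_distrib_right
      by (subst sum.swap) (simp add: S_def cnj_vec_def)
    then show ?thesis by (simp add: sum_left_kernel[OF y] monom_1_dvd_iff')
  qed
  moreover have "monom 1 1 dvd N$i$b" for i
  proof -
    have "coeff (N$i$b) 0 =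
        (\<Sum>r\<in>UNIV. S$i$r * (\<Sum>s\<in>UNIV. hmp_eval k B v $ r $ s * x$s))"
      unfolding coeffN coeff_line_mat_0 sum_distrib_left by (simp add: T_def mult_ac)
    then show ?thesis by (simp add: sum_right_kernel[OF x] monom_1_dvd_iff')
  qed
  \<comment> \<open>The common entry is \<open>y^* P(v + t u) x\<close>: its constant coefficient
    vanishes because \<open>x\<close> is an eigenvector, its linear one by the assumption on the
    pairing.\<close>
  moreover have "(monom 1 1)^2 dvd N$a$b"
  proof -
    have "coeff (N$a$b) m = (\<Sum>r\<in>UNIV. \<Sum>s\<in>UNIV. cnj (y$r) * coeff (line_mat k B v u $ r $ s) m * x$s)" for m
      unfolding coeffN by (simp add: S_def T_def cnj_vec_def)
    then have "coeff (N$a$b) 0 = bil y (hmp_eval k B v) x" "coeff (N$a$b) 1 = bil y (hmp_dir k B v u) x"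
      by (simp_all only: coeff_line_mat_0 coeff_line_mat_1 bil_expand)
    then show ?thesis
      using right_eigenvector_bil_0[OF x] 0
      by (simp add: monom_power monom_1_dvd_iff' less_2_cases_iff)
  qed
  ultimately have "(monom 1 1)^2 dvd det N" by (rule square_dvd_det)
  then show ?thesis using a b by (simp add: detN monom_power dvd_smult_iff)
qed

text \<open>Every constant \<open>[:a:]\<close> is a root of \<open>F\<close> in the coefficient
  ring, and a nonzero polynomial over a domain has only finitely many roots.\<close>

lemma poly_poly_all_0:
  fixes F :: "complex poly poly"
  assumes "\<And>a b. poly (poly F [:a:]) b = 0"
  shows "F = 0"
proof -
  have 0: "poly F [:a:] = 0" for a using assms poly_all_0_iff_0 by blast
  have "infinite (range (\<lambda>a::complex. [:a:]))"
    using infinite_UNIV_char_0 finite_imageD[of "\<lambda>a::complex. [:a:]" UNIV] by (auto simp: inj_on_def)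
  moreover have "range (\<lambda>a. [:a:]) \<subseteq> {x. poly F x = 0}" using 0 by auto
  ultimately show ?thesis using poly_roots_finite finite_subset by blast
qed

lemma det_mscale: "det (c *m M) = c ^ CARD('n) * det (M :: complex^'n^'n)"
  by (simp add: det_def mscale_def prod.distrib sum_distrib_left mult_ac)

lemma poly_linear_form:
  "poly (poly (linear_form v) [:a:]) b = v$2 * a - v$1 * b"
  by (simp add: linear_form_def poly_monom)

text \<open>With \<open>S(w) = v\<^sup>* w\<close> and \<open>T\<close> the linear form of \<open>v\<close>, homogeneity gives
  \<open>det P(|v|\<^sup>2 w) = S\<^sup>N p(T/S)\<close> for \<open>p(t) = det P(v + t v\<^sup>\<bottom>)\<close>. Multiplying the difference of both
  sides, as polynomials in \<open>w\<close>, by \<open>S\<close> avoids the points with \<open>S(w) = 0\<close>.\<close>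

lemma linear_form_square_dvd:
  fixes B :: "nat \<Rightarrow> complex^'n^'n"
  assumes v: "v \<noteq> 0" and dvd: "monom 1 2 dvd det (line_mat k B v (perp v))"
  shows "(linear_form v)^2 dvd hmp_det k B"
proof -
  define N where "N = k * CARD('n)"
  define p where "p = det (line_mat k B v (perp v))"
  define T where "T = linear_form v"
  define S :: "complex poly poly" where "S = [:[:0, cnj (v$2):], [:cnj (v$1):]:]"
  define c :: complex where "c = of_real ((norm v)\<^sup>2)"
  \<comment> \<open>The homogenization of \<open>p\<close> to degree \<open>N\<close> in the two
    linear forms, that is \<open>S^N p(T/S)\<close> without division.\<close>
  define H where "H = (\<Sum>j\<le>N. [:[:coeff p j:]:] * T^j * S^(N - j))"
  have c0: "c \<noteq> 0" using v by (simp add: c_def)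
  have S0: "S \<noteq> 0" using v by (auto simp: S_def vec_eq_iff forall_2)
  have det_scale: "det (hmp_eval k B (z *s u)) = z^N * det (hmp_eval k B u)" for z u
    unfolding hmp_eval_scale det_mscale N_def power_mult ..
  have "([:[:c^N:]:] * hmp_det k B - H) * S = 0"
  proof (rule poly_poly_all_0)
    fix a b
    define w :: "complex^2" where "w = vector [a, b]"
    define s where "s = cnj (v$1) * a + cnj (v$2) * b"
    define t where "t = v$2 * a - v$1 * b"
    have Ss: "poly (poly S [:a:]) b = s" by (simp add: S_def s_def mult.commute)
    have Tt: "poly (poly T [:a:]) b = t" by (simp add: T_def t_def poly_linear_form)
    have F: "poly (poly (hmp_det k B) [:a:]) b = det (hmp_eval k B w)"
      using poly_hmp_det[of k B w] by (simp add: w_def)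
    have H: "poly (poly H [:a:]) b = (\<Sum>j\<le>N. coeff p j * t^j * s^(N - j))"
      by (simp add: H_def poly_sum Ss Tt mult.assoc)
    show "poly (poly (([:[:c^N:]:] * hmp_det k B - H) * S) [:a:]) b = 0"
    proof (cases "s = 0")
      case True
      then show ?thesis by (simp add: Ss)
    next
      case False
      \<comment> \<open>Expansion of \<open>w\<close> in the orthogonal basis \<open>v\<close>,
        \<open>perp v\<close>, whose members both have squared length \<open>c\<close>.\<close>
      have "c *s w = s *s (v + (t / s) *s perp v)"
        using False unfolding c_def norm_vec2_sq
        by (simp add: vec_eq_iff forall_2 w_def s_def t_def field_simps)
      then have "c^N * det (hmp_eval k B w) = s^N * poly p (t / s)"
        unfolding p_def poly_det_line_mat by (metis det_scale)
      moreover have "s^N * poly p (t / s) = (\<Sum>j\<le>N. coeff p j * t^j * s^(N - j))"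
      proof -
        have "degree p \<le> N" unfolding p_def N_def by (rule degree_det_line_mat)
        then have "poly p (t / s) = (\<Sum>j\<le>N. coeff p j * (t / s)^j)"
          unfolding poly_altdef by (intro sum.mono_neutral_left) (auto simp: coeff_eq_0)
        moreover have "s^N * (t / s)^j = t^j * s^(N - j)" if "j \<le> N" for j
          using False that by (simp add: power_divide power_diff)
        ultimately show ?thesis
          by (auto simp: sum_distrib_left mult_ac intro!: sum.cong)
      qed
      ultimately show ?thesis by (simp add: F H)
    qed
  qed
  then have HF: "[:[:c^N:]:] * hmp_det k B = H" using S0 by simp
  \<comment> \<open>The hypothesis removes the coefficients of \<open>p\<close> at 0 and 1; every
    other summand contains \<open>T^j\<close> with \<open>j\<close> at least 2.\<close>
  have "T^2 dvd H"
    unfolding H_def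
  proof (intro dvd_sum)
    fix j
    show "T^2 dvd [:[:coeff p j:]:] * T^j * S^(N - j)"
    proof (cases "j < 2")
      case True
      then show ?thesis using dvd by (simp add: p_def monom_1_dvd_iff')
    next
      case False
      then show ?thesis by (intro dvd_mult2 dvd_mult le_imp_power_dvd) simp
    qed
  qed
  moreover have "hmp_det k B = [:[:inverse (c^N):]:] * H"
    using c0 by (simp flip: HF one_pCons)
  ultimately show ?thesis by (simp only: T_def dvd_mult)
qed

text \<open>A vanishing pairing would make the square of the linear form divide
  \<open>det P\<close>, forcing multiplicity at least 2.\<close>

lemma bil_perp_nonzero:
  assumes reg: "hmp_regular k B" and v: "v \<noteq> 0" and mult: "multiplicity (linear_form v) (hmp_det k B) = 1"
    and x: "right_eigenvector k B v x" and y: "left_eigenvector k B v y"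
  shows "bil y (hmp_dir k B v (perp v)) x \<noteq> 0"
proof
  assume "bil y (hmp_dir k B v (perp v)) x = 0"
  then have "(linear_form v)^2 dvd hmp_det k B"
    by (rule linear_form_square_dvd[OF v square_dvd_det_line_mat[OF x y]])
  \<comment> \<open>\<open>multiplicity\<close> is 0 by default for the zero polynomial and for unit
    divisors. Regularity excludes the former, the zero of the linear form at \<open>v\<close> the
    latter.\<close>
  moreover have "hmp_det k B \<noteq> 0"
    using reg by (auto simp: hmp_regular_def simp flip: poly_hmp_det)
  moreover have "\<not> is_unit (linear_form v)"
  proof
    assume "is_unit (linear_form v)"
    then obtain G where "1 = linear_form v * G" by (elim dvdE)
    then have "poly (poly (linear_form v * G) [:v$1:]) (v$2) = 1" by simp
    then show False by (simp add: poly_linear_form)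
  qed
  ultimately have "2 \<le> multiplicity (linear_form v) (hmp_det k B)" by (intro multiplicity_geI) auto
  then show False using mult by simp
qed

section \<open>The condition number and its quotient\<close>

text \<open>The sum \<open>N(P, v)\<close> of the opening comment.\<close>

definition hmp_weight :: "nat \<Rightarrow> (nat \<Rightarrow> complex^'n^'m) \<Rightarrow> complex^2 \<Rightarrow> real" where
  "hmp_weight k B v = (\<Sum>i\<le>k. norm (v$1)^i * norm (v$2)^(k - i) * spectral_norm (B i))"

section \<open>Independence of the representative and of the eigenvectors\<close>

lemma norm_scalar_mult: "norm (c *s x) = norm c * norm (x :: complex^'n)"
  by (simp add: norm_vec_def L2_set_def norm_mult power_mult_distrib sum_distrib_left[symmetric] real_sqrt_mult)

lemma line_eqE:
  assumes "line v = line u" and "v \<noteq> 0"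
  obtains s where "s \<noteq> 0" "v = s *s u"
proof -
  have "v \<in> line v" by (simp add: line_def vec.span_base)
  then obtain s where "v = s *s u" using assms by (auto simp: line_def vec.span_singleton)
  moreover have "s \<noteq> 0" using calculation assms by auto
  ultimately show ?thesis using that by blast
qed

lemma mscale_mult_vec: "(c *m M) *v x = c *s (M *v x)" "y v* (c *m M) = c *s (y v* M)"
  by (simp_all add: mscale_def matrix_vector_mult_def vector_matrix_mult_def vec_eq_iff sum_distrib_left mult_ac)

lemma right_eigenvector_scale:
  "s \<noteq> 0 \<Longrightarrow> right_eigenvector k B (s *s v) x \<longleftrightarrow> right_eigenvector k B v x"
  by (simp add: right_eigenvector_def hmp_eval_scale mscale_mult_vec)

lemma left_eigenvector_scale:
  "s \<noteq> 0 \<Longrightarrow> left_eigenvector k B (s *s v) y \<longleftrightarrow> left_eigenvector k B v y"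
  by (simp add: left_eigenvector_def hmp_eval_scale mscale_mult_vec)

text \<open>The derivative contributes degree \<open>k - 1\<close> and the conjugate-linear
  \<open>perp\<close> one more factor of modulus \<open>|s|\<close>. The resulting degree
  \<open>k\<close> matches that of the weight sum.\<close>

lemma norm_bil_perp_scale:
  assumes "s \<noteq> 0"
  shows "norm (bil y (hmp_dir k B (s *s v) (perp (s *s v))) x) =
    norm s ^ k * norm (bil y (hmp_dir k B v (perp v)) x)"
proof -
  have "hmp_dir k B (s *s v) (perp (s *s v)) = cnj s *m hmp_dir k B (s *s v) (perp v)"
    by (simp add: hmp_dir_def mscale_def vec_eq_iff algebra_simps)
  then have "norm (bil y (hmp_dir k B (s *s v) (perp (s *s v))) x) =
      norm (bil y (s *m hmp_dir k B (s *s v) (perp v)) x)"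
    by (simp add: bil_mscale norm_mult)
  then show ?thesis by (simp add: hmp_dir_scale[OF assms] bil_mscale norm_mult norm_power)
qed

text \<open>A nondegenerate pairing forces both eigenspaces to be one-dimensional.\<close>

lemma right_eigenvector_unique:
  assumes nz: "\<And>x. right_eigenvector k B v x \<Longrightarrow> bil y M x \<noteq> 0"
    and x: "right_eigenvector k B v x" and x': "right_eigenvector k B v x'"
  shows "\<exists>c. c \<noteq> 0 \<and> x' = c *s x"
proof -
  \<comment> \<open>This kernel vector is chosen to pair to zero with \<open>y\<close>; by
    nondegeneracy it cannot be an eigenvector, so it is 0.\<close>
  let ?z = "bil y M x *s x' + (- bil y M x') *s x"
  have "bil y M ?z = 0" by (simp only: bil_vec_right) simp
  moreover have "hmp_eval k B v *v ?z = 0"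
    using x x' by (simp only: right_eigenvector_def matrix_vector_right_distrib vector_scalar_commute) simp
  ultimately have "?z = 0" using nz[of ?z] by (auto simp: right_eigenvector_def)
  then have "bil y M x *s x' = bil y M x' *s x" by (simp add: vec_eq_iff)
  then have "x' = (bil y M x' / bil y M x) *s x"
    using nz[OF x] by (simp add: vec_eq_iff field_simps)
  moreover have "bil y M x' / bil y M x \<noteq> 0" using nz[OF x] nz[OF x'] by simp
  ultimately show ?thesis by blast
qed

text \<open>The argument for right eigenvectors, with conjugated coefficients because
  \<open>bil\<close> is conjugate-linear in \<open>y\<close>.\<close>

lemma left_eigenvector_unique:
  assumes nz: "\<And>y. left_eigenvector k B v y \<Longrightarrow> bil y M x \<noteq> 0"
    and y: "left_eigenvector k B v y" and y': "left_eigenvector k B v y'"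
  shows "\<exists>c. c \<noteq> 0 \<and> y' = c *s y"
proof -
  define p q where "p = bil y M x" and "q = bil y' M x"
  let ?z = "cnj p *s y' + (- cnj q) *s y"
  have "bil ?z M x = 0" unfolding bil_vec_left by (simp add: p_def q_def)
  moreover have "cnj_vec ?z v* hmp_eval k B v = 0"
  proof -
    have "cnj_vec ?z = p *s cnj_vec y' + (- q) *s cnj_vec y"
      by (simp add: cnj_vec_def vec_eq_iff)
    then show ?thesis using y y'
      unfolding left_eigenvector_def
      by (simp add: vector_matrix_left_distrib scalar_vector_matrix_assoc vector_matrix_mult_diff_distrib)
  qed
  ultimately have "?z = 0" using nz[of ?z] by (auto simp: left_eigenvector_def)
  then have "cnj p *s y' = cnj q *s y" by (simp add: vec_eq_iff)
  moreover have "p \<noteq> 0" "q \<noteq> 0" using nz[OF y] nz[OF y'] by (simp_all add: p_def q_def)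
  ultimately have "y' = (cnj q / cnj p) *s y" "cnj q / cnj p \<noteq> 0"
    by (simp_all add: vec_eq_iff field_simps)
  then show ?thesis by blast
qed

text \<open>Numerator and denominator both acquire the factor \<open>|s|^k |a| |b|\<close>.\<close>

lemma stewart_sun_value_scale:
  assumes "s \<noteq> 0" "a \<noteq> 0" "b \<noteq> 0"
  shows "stewart_sun_value k B \<omega> (s *s v) (a *s x) (b *s y) = stewart_sun_value k B \<omega> v x y"
proof -
  have "norm ((s *s v)$1)^i * norm ((s *s v)$2)^(k - i) * \<omega> i =
      norm s ^ k * (norm (v$1)^i * norm (v$2)^(k - i) * \<omega> i)" if "i \<le> k" for i
    using that by (simp add: norm_mult power_mult_distrib mult_ac flip: power_add)
  then have "(\<Sum>i\<le>k. norm ((s *s v)$1)^i * norm ((s *s v)$2)^(k - i) * \<omega> i) =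
      norm s ^ k * (\<Sum>i\<le>k. norm (v$1)^i * norm (v$2)^(k - i) * \<omega> i)"
    unfolding sum_distrib_left by (intro sum.cong) auto
  then show ?thesis
    using assms unfolding stewart_sun_value_bil bil_scale_left bil_scale_right norm_mult norm_bil_perp_scale[OF assms(1)]
    by (simp add: norm_scalar_mult)
qed

text \<open>The definite description is justified: nondegeneracy makes all eigenvectors multiples of
  \<open>x\<close> and \<open>y\<close>, and the value is invariant under scaling.\<close>

lemma kappa_theta_eq:
  assumes v: "v \<noteq> 0" and x: "right_eigenvector k B v x" and y: "left_eigenvector k B v y"
    and nz: "\<And>x y. right_eigenvector k B v x \<Longrightarrow> left_eigenvector k B v y \<Longrightarrow>
      bil y (hmp_dir k B v (perp v)) x \<noteq> 0"
  shows "kappa_theta k B \<omega> (line v) = stewart_sun_value k B \<omega> v x y"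
  unfolding kappa_theta_def
proof (rule the_equality)
  show "\<exists>v' x' y'. v' \<noteq> 0 \<and> line v = line v' \<and> right_eigenvector k B v' x' \<and>
      left_eigenvector k B v' y' \<and> stewart_sun_value k B \<omega> v x y = stewart_sun_value k B \<omega> v' x' y'"
    using v x y by blast
next
  fix r assume "\<exists>v' x' y'. v' \<noteq> 0 \<and> line v = line v' \<and> right_eigenvector k B v' x' \<and>
      left_eigenvector k B v' y' \<and> r = stewart_sun_value k B \<omega> v' x' y'"
  then obtain v' x' y' where v': "v' \<noteq> 0" "line v' = line v"
    and e: "right_eigenvector k B v' x'" "left_eigenvector k B v' y'"
    and r: "r = stewart_sun_value k B \<omega> v' x' y'" by metis
  obtain s where s: "s \<noteq> 0" "v' = s *s v" using line_eqE[OF v'(2,1)] by blast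
  have x': "right_eigenvector k B v x'" and y': "left_eigenvector k B v y'"
    using e s by (simp_all add: right_eigenvector_scale left_eigenvector_scale)
  obtain a where "a \<noteq> 0" "x' = a *s x" using right_eigenvector_unique[OF nz[OF _ y] x x'] by blast
  moreover obtain b where "b \<noteq> 0" "y' = b *s y" using left_eigenvector_unique[OF nz[OF x] y y'] by blast
  ultimately show "r = stewart_sun_value k B \<omega> v x y"
    unfolding r s(2) using stewart_sun_value_scale[OF s(1)] by blast
qed

text \<open>Simplicity provides the multiplicity only for some representative \<open>u\<close> of
  the line; the scaling law carries nondegeneracy over to \<open>v\<close>.\<close>

lemma simple_eigenvalue_nondegenerate:
  assumes reg: "hmp_regular k B" and v: "v \<noteq> 0" and simple: "simple_eigenvalue k B (line v)"
    and x: "right_eigenvector k B v x" and y: "left_eigenvector k B v y"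
  shows "bil y (hmp_dir k B v (perp v)) x \<noteq> 0"
proof -
  obtain u where u: "u \<noteq> 0" "line v = line u" "multiplicity (linear_form u) (hmp_det k B) = 1"
    using simple unfolding simple_eigenvalue_def by blast
  obtain s where s: "s \<noteq> 0" "v = s *s u" using line_eqE[OF u(2) v] by blast
  have "bil y (hmp_dir k B u (perp u)) x \<noteq> 0"
    using x y s by (intro bil_perp_nonzero[OF reg u(1,3)]) (simp_all add: right_eigenvector_scale left_eigenvector_scale)
  then show ?thesis using norm_bil_perp_scale[OF s(1), of y k B u x] s
    by (metis mult_eq_0_iff norm_eq_zero power_not_zero)
qed

lemma simple_eigenvalue_det:
  assumes "v \<noteq> 0" and "simple_eigenvalue k B (line v)"
  shows "det (hmp_eval k B v) = 0"
proof -
  obtain u where u: "line v = line u" "det (hmp_eval k B u) = 0"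
    using assms(2) unfolding simple_eigenvalue_def by blast
  then obtain s where "v = s *s u" using line_eqE[OF u(1) assms(1)] by blast
  then show ?thesis using u(2) by (simp add: hmp_eval_scale det_mscale)
qed

lemma det_0_right_kernel:
  fixes M :: "'a::field^'n^'n"
  assumes "det M = 0"
  shows "\<exists>x. x \<noteq> 0 \<and> M *v x = 0"
  using assms matrix_left_invertible_ker[of M] invertible_left_inverse[of M] invertible_det_nz[of M] by blast

lemma ex_eigenvectors:
  assumes "det (hmp_eval k B v) = 0"
  obtains x y where "right_eigenvector k B v x" "left_eigenvector k B v y"
proof -
  obtain x where x: "x \<noteq> 0" "hmp_eval k B v *v x = 0" using det_0_right_kernel[OF assms] by blast
  obtain z where z: "z \<noteq> 0" "transpose (hmp_eval k B v) *v z = 0"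
    using det_0_right_kernel[of "transpose (hmp_eval k B v)"] assms by (auto simp: det_transpose)
  have "cnj_vec (cnj_vec z) = z" by (simp add: cnj_vec_def vec_eq_iff)
  moreover have "cnj_vec z \<noteq> 0" using z(1) by (simp add: cnj_vec_def vec_eq_iff)
  ultimately have "left_eigenvector k B v (cnj_vec z)"
    using z(2) by (simp add: left_eigenvector_def)
  then show ?thesis using x that by (auto simp: right_eigenvector_def)
qed

text \<open>Since \<open>M_A(P)(w) = P(A w)\<close>, the eigenvectors are shared. Their norms and
  the pairing cancel, leaving the two weights and the factor from
  \<open>bil_moebius_perp\<close>.\<close>

lemma Q_theta_r_eq:
  assumes reg: "hmp_regular k B" and v: "A *v w \<noteq> 0" and simple: "simple_eigenvalue k B (line (A *v w))"
    and A: "det A \<noteq> 0" and w: "w = matrix_inv A *v (A *v w)"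
  shows "Q_theta_r k A B (A *v w) =
    hmp_weight k (moebius_coeff k A B) w * (norm (A *v w))\<^sup>2 /
      (norm (det A) * (norm w)\<^sup>2 * hmp_weight k B (A *v w))"
proof -
  define v where "v = A *v w"
  let ?B = "moebius_coeff k A B"
  have v0: "v \<noteq> 0" and w0: "w \<noteq> 0" using assms(2) by (auto simp: v_def)
  obtain x y where x: "right_eigenvector k B v x" and y: "left_eigenvector k B v y"
    using ex_eigenvectors[OF simple_eigenvalue_det[OF assms(2) simple]] unfolding v_def by blast
  have R: "right_eigenvector k ?B w = right_eigenvector k B v" "left_eigenvector k ?B w = left_eigenvector k B v"
    by (simp_all add: fun_eq_iff right_eigenvector_def left_eigenvector_def hmp_eval_moebius v_def)
  have nz: "bil y (hmp_dir k B v (perp v)) x \<noteq> 0" if "right_eigenvector k B v x" "left_eigenvector k B v y" for x y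
    using simple_eigenvalue_nondegenerate[OF reg assms(2) simple] that unfolding v_def by blast
  have tr: "norm (bil y (hmp_dir k ?B w (perp w)) x) =
      norm (det A) * (norm w)\<^sup>2 * norm (bil y (hmp_dir k B v (perp v)) x) / (norm v)\<^sup>2"
    if "right_eigenvector k B v x" for x y
    using arg_cong[OF bil_moebius_perp[of k B A w x y], of norm] that v0
    by (simp add: norm_mult norm_power field_simps flip: v_def)
  have nz': "bil y (hmp_dir k ?B w (perp w)) x \<noteq> 0"
    if "right_eigenvector k ?B w x" "left_eigenvector k ?B w y" for x y
    using tr[of x y] nz[of x y] that v0 w0 A unfolding R by auto
  have "kappa_theta_r k B (line v) = stewart_sun_value k B (\<lambda>i. spectral_norm (B i)) v x y"
    unfolding kappa_theta_r_def by (rule kappa_theta_eq[OF v0 x y nz])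
  moreover have "kappa_theta_r k ?B (line w) = stewart_sun_value k ?B (\<lambda>i. spectral_norm (?B i)) w x y"
    unfolding kappa_theta_r_def by (rule kappa_theta_eq[OF w0 _ _ nz']) (simp_all add: R x y)
  moreover have "norm x \<noteq> 0" "norm y \<noteq> 0"
    using x y by (simp_all add: right_eigenvector_def left_eigenvector_def)
  ultimately show ?thesis
    using nz[OF x y] v0 w0 A unfolding Q_theta_r_def v_def[symmetric] w[folded v_def, symmetric]
    by (simp add: stewart_sun_value_bil tr[OF x] hmp_weight_def[symmetric])
qed

section \<open>Norm estimates\<close>

lemma spectral_norm_nonneg: "0 \<le> spectral_norm (M :: complex^'n^'m)"
  unfolding spectral_norm_def by (intro onorm_pos_le matrix_vector_mul_bounded_linear)

lemma spectral_norm_pos: "M \<noteq> 0 \<Longrightarrow> 0 < spectral_norm (M :: complex^'n^'m)"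
proof -
  assume "M \<noteq> 0"
  then have "\<exists>x. M *v x \<noteq> 0 *v x" using matrix_eq by metis
  then show ?thesis unfolding spectral_norm_def by (subst onorm_pos_lt) auto
qed

lemma spectral_norm_mscale: "spectral_norm (c *m M) \<le> norm c * spectral_norm (M :: complex^'n^'m)"
proof -
  have "norm ((c *m M) *v x) \<le> norm c * onorm ((*v) M) * norm x" for x
    using mult_left_mono[OF onorm[OF matrix_vector_mul_bounded_linear[of M], of x], of "norm c"]
    by (simp add: mscale_mult_vec norm_scalar_mult mult.assoc)
  then show ?thesis unfolding spectral_norm_def by (rule onorm_le)
qed

lemma spectral_norm_sum:
  assumes "finite S"
  shows "spectral_norm (\<Sum>i\<in>S. M i :: complex^'n^'m) \<le> (\<Sum>i\<in>S. spectral_norm (M i))"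
proof -
  have "(\<Sum>i\<in>S. M i) *v x = (\<Sum>i\<in>S. M i *v x)" for x
    using assms by (induction S) (simp_all add: matrix_vector_mult_add_rdistrib)
  then have "(*v) (\<Sum>i\<in>S. M i) = (\<lambda>x. \<Sum>i\<in>S. M i *v x)" by (rule ext)
  then show ?thesis unfolding spectral_norm_def
    using onorm_sum[OF assms, of "\<lambda>i. (*v) (M i)"] by simp
qed

text \<open>The version of \<open>homogenize_linear_mult\<close> with absolute values. Bounding the
  whole weighted sum of coefficients at once keeps binomial coefficients out of the
  estimate.\<close>

lemma sum_norm_coeff_linear_mult:
  fixes p :: "complex poly"
  assumes p: "degree p \<le> n" and xy: "0 \<le> x" "0 \<le> y"
  shows "(\<Sum>l\<le>Suc n. x^l * y^(Suc n - l) * norm (coeff ([:b, a:] * p) l)) \<le>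
    (norm a * x + norm b * y) * (\<Sum>l\<le>n. x^l * y^(n - l) * norm (coeff p l))"
proof -
  \<comment> \<open>The top coefficient vanishes, so the sum up to \<open>Suc n\<close> loses its
    last term and a factor \<open>y\<close> can be pulled out.\<close>
  have z: "coeff p (Suc n) = 0" using p by (simp add: coeff_eq_0)
  have "(\<Sum>l\<le>Suc n. x^l * y^(Suc n - l) * norm (coeff ([:b, a:] * p) l)) \<le>
      (\<Sum>l\<le>Suc n. x^l * y^(Suc n - l) * (norm b * norm (coeff p l) + norm (coeff (pCons 0 (smult a p)) l)))"
  proof (intro sum_mono mult_left_mono)
    fix l
    have "coeff ([:b, a:] * p) l = b * coeff p l + coeff (pCons 0 (smult a p)) l" by simp
    then show "norm (coeff ([:b, a:] * p) l) \<le> norm b * norm (coeff p l) + norm (coeff (pCons 0 (smult a p)) l)"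
      by (metis norm_mult norm_triangle_ineq)
  qed (use xy in simp)
  also have "\<dots> = norm b * (\<Sum>l\<le>Suc n. x^l * y^(Suc n - l) * norm (coeff p l)) +
      (\<Sum>l\<le>Suc n. x^l * y^(Suc n - l) * norm (coeff (pCons 0 (smult a p)) l))"
    unfolding sum_distrib_left sum.distrib[symmetric] by (simp only: algebra_simps)
  also have "(\<Sum>l\<le>Suc n. x^l * y^(Suc n - l) * norm (coeff (pCons 0 (smult a p)) l)) =
      norm a * x * (\<Sum>l\<le>n. x^l * y^(n - l) * norm (coeff p l))"
    unfolding sum.atMost_Suc_shift sum_distrib_left by (simp add: norm_mult algebra_simps)
  also have "(\<Sum>l\<le>Suc n. x^l * y^(Suc n - l) * norm (coeff p l)) =
      y * (\<Sum>l\<le>n. x^l * y^(n - l) * norm (coeff p l))"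
    unfolding sum.atMost_Suc sum_distrib_left by (simp add: z Suc_diff_le algebra_simps)
  finally show ?thesis by (simp add: algebra_simps)
qed

lemma sum_norm_coeff_linear_power_mult:
  fixes p :: "complex poly"
  assumes p: "degree p \<le> n" and xy: "0 \<le> x" "0 \<le> y"
  shows "(\<Sum>l\<le>m + n. x^l * y^(m + n - l) * norm (coeff ([:b, a:]^m * p) l)) \<le>
    (norm a * x + norm b * y)^m * (\<Sum>l\<le>n. x^l * y^(n - l) * norm (coeff p l))"
proof (induction m)
  case (Suc m)
  let ?q = "[:b, a:]^m * p" and ?f = "norm a * x + norm b * y"
  have eq: "[:b, a:]^Suc m * p = [:b, a:] * ?q" by (simp only: power_Suc mult.assoc)
  have "(\<Sum>l\<le>Suc (m + n). x^l * y^(Suc (m + n) - l) * norm (coeff ([:b, a:] * ?q) l)) \<le>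
      ?f * (\<Sum>l\<le>m + n. x^l * y^(m + n - l) * norm (coeff ?q l))"
    using homogenize_linear_power_mult[OF p, of b a m] by (intro sum_norm_coeff_linear_mult xy) simp
  also have "\<dots> \<le> ?f * (?f^m * (\<Sum>l\<le>n. x^l * y^(n - l) * norm (coeff p l)))"
    using Suc.IH xy by (intro mult_left_mono) simp_all
  finally show ?case unfolding eq by (simp only: add_Suc power_Suc mult.assoc)
qed simp

text \<open>After the triangle inequality and an exchange of sums, the inner sum over
  \<open>l\<close> is the weighted coefficient sum of a product of linear forms. Here
  \<open>p\<close> and \<open>q\<close> are the entries of \<open>|A| |w|\<close>, with moduli taken
  entrywise.\<close>

lemma hmp_weight_moebius_le:
  fixes B :: "nat \<Rightarrow> complex^'n^'m" and A :: "complex^2^2" and w :: "complex^2"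
  defines "p \<equiv> norm (A$1$1) * norm (w$1) + norm (A$1$2) * norm (w$2)"
    and "q \<equiv> norm (A$2$1) * norm (w$1) + norm (A$2$2) * norm (w$2)"
  shows "hmp_weight k (moebius_coeff k A B) w \<le>
    (\<Sum>i\<le>k. p ^ i * q ^ (k - i) * spectral_norm (B i))"
proof -
  define f where "f i l = coeff ([:A$1$2, A$1$1:]^i * [:A$2$2, A$2$1:]^(k - i)) l" for i l
  have f: "(\<Sum>l\<le>k. norm (w$1)^l * norm (w$2)^(k - l) * norm (f i l)) \<le> p ^ i * q ^ (k - i)"
    if "i \<le> k" for i
  proof -
    let ?r = "[:A$2$2, A$2$1:]^(k - i)"
    have 1: "degree ?r \<le> k - i"
      using homogenize_linear_power_mult[of 1 0 "A$2$2" "A$2$1" "k - i"] by simp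
    have 2: "(\<Sum>l\<le>k - i. norm (w$1)^l * norm (w$2)^(k - i - l) * norm (coeff ?r l)) \<le> q ^ (k - i)"
      using sum_norm_coeff_linear_power_mult[of 1 0 "norm (w$1)" "norm (w$2)" "k - i" "A$2$2" "A$2$1"]
      by (simp add: q_def)
    have "i + (k - i) = k" using that by simp
    then have "(\<Sum>l\<le>k. norm (w$1)^l * norm (w$2)^(k - l) * norm (f i l)) \<le> p ^ i *
        (\<Sum>l\<le>k - i. norm (w$1)^l * norm (w$2)^(k - i - l) * norm (coeff ?r l))"
      using sum_norm_coeff_linear_power_mult[OF 1, of "norm (w$1)" "norm (w$2)" i "A$1$2" "A$1$1"]
      unfolding f_def p_def by simp
    also have "\<dots> \<le> p ^ i * q ^ (k - i)"
      by (intro mult_left_mono 2) (simp add: p_def)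
    finally show ?thesis .
  qed
  have "hmp_weight k (moebius_coeff k A B) w \<le>
      (\<Sum>l\<le>k. norm (w$1)^l * norm (w$2)^(k - l) * (\<Sum>i\<le>k. norm (f i l) * spectral_norm (B i)))"
    unfolding hmp_weight_def
  proof (intro sum_mono mult_left_mono)
    fix l
    have "spectral_norm (moebius_coeff k A B l) \<le> (\<Sum>i\<le>k. spectral_norm (f i l *m B i))"
      unfolding moebius_coeff_def f_def by (rule spectral_norm_sum) simp
    also have "\<dots> \<le> (\<Sum>i\<le>k. norm (f i l) * spectral_norm (B i))"
      by (intro sum_mono spectral_norm_mscale)
    finally show "spectral_norm (moebius_coeff k A B l) \<le> (\<Sum>i\<le>k. norm (f i l) * spectral_norm (B i))" .
  qed simp
  also have "\<dots> = (\<Sum>i\<le>k. \<Sum>l\<le>k. norm (w$1)^l * norm (w$2)^(k - l) * norm (f i l) * spectral_norm (B i))"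
    unfolding sum_distrib_left mult.assoc by (rule sum.swap)
  also have "\<dots> = (\<Sum>i\<le>k. (\<Sum>l\<le>k. norm (w$1)^l * norm (w$2)^(k - l) * norm (f i l)) * spectral_norm (B i))"
    unfolding sum_distrib_right ..
  also have "\<dots> \<le> (\<Sum>i\<le>k. p ^ i * q ^ (k - i) * spectral_norm (B i))"
    by (intro sum_mono mult_right_mono f spectral_norm_nonneg) simp
  finally show ?thesis .
qed

text \<open>Setting the second variable to 1 reduces this to equality of univariate
  polynomials.\<close>

lemma hmp_eval_inject:
  assumes "\<And>v. hmp_eval k B v = hmp_eval k C v" and "l \<le> k"
  shows "B l = C l"
proof -
  have "B l $ r $ c = C l $ r $ c" for r c
  proof -
    have "poly (\<Sum>i\<le>k. monom (B i $ r $ c) i) t = poly (\<Sum>i\<le>k. monom (C i $ r $ c) i) t" for t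
      using assms(1)[of "vector [t, 1]", THEN arg_cong, of "\<lambda>M. M $ r $ c"]
      by (simp add: hmp_eval_component poly_sum poly_monom mult_ac)
    then have "(\<Sum>i\<le>k. monom (B i $ r $ c) i) = (\<Sum>i\<le>k. monom (C i $ r $ c) i)"
      by (simp add: fun_eq_iff flip: poly_eq_poly_eq_iff)
    then have "coeff (\<Sum>i\<le>k. monom (B i $ r $ c) i) l = coeff (\<Sum>i\<le>k. monom (C i $ r $ c) i) l"
      by simp
    then show ?thesis using assms(2) by (simp add: coeff_sum)
  qed
  then show ?thesis by (simp add: vec_eq_iff)
qed

text \<open>This inversion lets the lower bound be read off from the upper bound for
  \<open>M_A(P)\<close> and the inverse of \<open>A\<close>.\<close>

lemma moebius_coeff_inverse:
  assumes "A ** A' = mat 1" and "l \<le> k"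
  shows "moebius_coeff k A' (moebius_coeff k A B) l = B l"
  using assms(2)
  by (rule hmp_eval_inject[rotated]) (simp add: hmp_eval_moebius matrix_vector_mul_assoc assms(1))

section \<open>Row-sum norms of two-by-two matrices and maximum norms of vectors\<close>

lemma norm_inf_2:
  "norm_inf (M :: complex^2^2) =
    max (norm (M$1$1) + norm (M$1$2)) (norm (M$2$1) + norm (M$2$2))"
proof -
  have "range (\<lambda>i. \<Sum>j\<in>UNIV. norm (M$i$j)) =
      {norm (M$1$1) + norm (M$1$2), norm (M$2$1) + norm (M$2$2)}"
    by (simp add: UNIV_2 sum_2)
  then show ?thesis by (simp add: norm_inf_def)
qed

text \<open>The adjugate formula, multiplied by \<open>det A\<close> to avoid division.\<close>

lemma matrix_inv_2:
  fixes A :: "complex^2^2"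
  assumes "A ** A' = mat 1"
  shows "det A * A'$1$1 = A$2$2" "det A * A'$1$2 = - A$1$2"
    "det A * A'$2$1 = - A$2$1" "det A * A'$2$2 = A$1$1"
proof -
  have "A$1$1 * A'$1$1 + A$1$2 * A'$2$1 = 1" "A$1$1 * A'$1$2 + A$1$2 * A'$2$2 = 0"
    "A$2$1 * A'$1$1 + A$2$2 * A'$2$1 = 0" "A$2$1 * A'$1$2 + A$2$2 * A'$2$2 = 1"
    using assms by (auto simp: vec_eq_iff forall_2 matrix_matrix_mult_def mat_def sum_2)
  then show "det A * A'$1$1 = A$2$2" "det A * A'$1$2 = - A$1$2"
    "det A * A'$2$1 = - A$2$1" "det A * A'$2$2 = A$1$1"
    unfolding det_2 by algebra+
qed

text \<open>Row sums of the adjugate are column sums of \<open>A\<close>, so the right-hand side is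
  the operator 1-norm of \<open>A\<close>.\<close>

lemma norm_det_norm_inf_inverse:
  fixes A :: "complex^2^2"
  assumes "A ** A' = mat 1"
  shows "norm (det A) * norm_inf A' =
    max (norm (A$1$2) + norm (A$2$2)) (norm (A$1$1) + norm (A$2$1))"
proof -
  have "norm (det A) * norm_inf A' = max (norm (det A * A'$1$1) + norm (det A * A'$1$2))
      (norm (det A * A'$2$1) + norm (det A * A'$2$2))"
    unfolding norm_inf_2 by (simp add: max_mult_distrib_left norm_mult distrib_left)
  then show ?thesis by (simp add: matrix_inv_2[OF assms] add.commute)
qed

text \<open>The vector norm that induces \<open>norm_inf\<close>; the type class norm is
  Euclidean.\<close>

definition max_norm :: "complex^2 \<Rightarrow> real" where
  "max_norm v = max (norm (v$1)) (norm (v$2))"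

lemma max_norm_nonneg: "0 \<le> max_norm v"
  by (simp add: max_norm_def le_max_iff_disj)

lemma max_norm_mult_le: "max_norm (M *v v) \<le> norm_inf M * max_norm v"
proof -
  have "norm ((M *v v)$i) \<le> (norm (M$i$1) + norm (M$i$2)) * max_norm v" for i
  proof -
    have "norm ((M *v v)$i) \<le> norm (M$i$1) * norm (v$1) + norm (M$i$2) * norm (v$2)"
      unfolding matrix_vector_mult_def by (simp add: sum_2) (metis norm_mult norm_triangle_ineq)
    also have "\<dots> \<le> norm (M$i$1) * max_norm v + norm (M$i$2) * max_norm v"
      by (intro add_mono mult_left_mono) (simp_all add: max_norm_def)
    finally show ?thesis by (simp add: algebra_simps)
  qed
  moreover have "(norm (M$i$1) + norm (M$i$2)) * max_norm v \<le> norm_inf M * max_norm v" for i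
    using exhaust_2[of i] by (intro mult_right_mono max_norm_nonneg) (auto simp: norm_inf_2)
  ultimately have "norm ((M *v v)$i) \<le> norm_inf M * max_norm v" for i
    using order_trans by blast
  then show ?thesis by (simp add: max_norm_def[of "M *v v"])
qed

lemma norm_sq_2: "(norm (v :: complex^2))\<^sup>2 = (norm (v$1))\<^sup>2 + (norm (v$2))\<^sup>2"
  by (simp add: norm_vec_def L2_set_def sum_2)

lemma max_norm_sq_le: "(max_norm v)\<^sup>2 \<le> (norm v)\<^sup>2"
  by (simp add: max_norm_def norm_sq_2 max_def)

text \<open>The 1-norm of \<open>v\<close> is kept as a factor because for \<open>k = 1\<close> it
  cancels against the weight in the denominator.\<close>

lemma norm_sq_le_max_norm: "(norm v)\<^sup>2 \<le> max_norm v * (norm (v$1) + norm (v$2))"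
  unfolding norm_sq_2 distrib_left unfolding power2_eq_square
  by (intro add_mono mult_right_mono) (simp_all add: max_norm_def)

lemma Max_spectral_norm_ge:
  fixes k :: nat shows
  "i \<le> k \<Longrightarrow> spectral_norm (B i) \<le> Max ((\<lambda>i. spectral_norm (B i)) ` {0..k})"
  by (intro Max_ge image_eqI[where x = i]) auto

text \<open>All summands are nonnegative; the extreme one containing only the larger coordinate
  already suffices.\<close>

lemma hmp_weight_ge:
  assumes "1 \<le> k"
  shows "min (spectral_norm (B 0)) (spectral_norm (B k)) * max_norm v ^ k \<le> hmp_weight k B v"
proof -
  let ?f = "\<lambda>i. norm (v$1)^i * norm (v$2)^(k - i) * spectral_norm (B i)"
  have ge: "?f i \<le> hmp_weight k B v" if "i \<le> k" for i
    unfolding hmp_weight_def using that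
    by (intro member_le_sum) (auto intro: mult_nonneg_nonneg spectral_norm_nonneg)
  show ?thesis
  proof (cases "norm (v$1) \<le> norm (v$2)")
    case True
    then have "min (spectral_norm (B 0)) (spectral_norm (B k)) * max_norm v ^ k \<le> ?f 0"
      by (simp add: max_norm_def max_absorb2 mult_right_mono mult.commute[of _ "spectral_norm (B 0)"])
    then show ?thesis using ge[of 0] by simp
  next
    case False
    then have "min (spectral_norm (B 0)) (spectral_norm (B k)) * max_norm v ^ k \<le> ?f k"
      by (simp add: max_norm_def max_absorb1 mult_right_mono mult.commute[of _ "spectral_norm (B k)"])
    then show ?thesis using ge[of k] by simp
  qed
qed

text \<open>For \<open>k = 1\<close> both summands are extreme, so the full 1-norm of
  \<open>v\<close> survives.\<close>

lemma hmp_weight_1_ge: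
  "min (spectral_norm (B 0)) (spectral_norm (B 1)) * (norm (v$1) + norm (v$2)) \<le> hmp_weight 1 B v"
proof -
  have "min (spectral_norm (B 0)) (spectral_norm (B 1)) * norm (v$2) \<le> spectral_norm (B 0) * norm (v$2)"
    "min (spectral_norm (B 0)) (spectral_norm (B 1)) * norm (v$1) \<le> spectral_norm (B 1) * norm (v$1)"
    by (simp_all add: mult_right_mono)
  then show ?thesis by (simp add: hmp_weight_def algebra_simps)
qed

text \<open>A row sum has two terms, each at most a column sum of \<open>A\<close>.\<close>

lemma norm_inf_le_norm_det:
  fixes A :: "complex^2^2"
  assumes "A ** A' = mat 1"
  shows "norm_inf A \<le> 2 * (norm (det A) * norm_inf A')"
  unfolding norm_det_norm_inf_inverse[OF assms] unfolding norm_inf_2 by (smt (verit) norm_ge_zero)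

lemma hmp_weight_moebius_bound_1:
  fixes A :: "complex^2^2" and B :: "nat \<Rightarrow> complex^'n^'m"
  assumes inv: "A ** A' = mat 1" and B: "B 0 \<noteq> 0" "B 1 \<noteq> 0"
  shows "hmp_weight 1 (moebius_coeff 1 A B) w * (norm (A *v w))\<^sup>2 \<le>
    4 * (norm_inf A * norm_inf A') * coeff_ratio 1 B * (norm (det A) * (norm w)\<^sup>2 * hmp_weight 1 B (A *v w))"
proof -
  define v where "v = A *v w"
  define M where "M = Max ((\<lambda>i. spectral_norm (B i)) ` {0..1})"
  define c where "c = min (spectral_norm (B 0)) (spectral_norm (B 1))"
  define D where "D = norm (det A)"
  define N N' where "N = norm_inf A" and "N' = norm_inf A'"
  define r s where "r = norm (w$1)" and "s = norm (w$2)"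
  define V where "V = norm (v$1) + norm (v$2)"
  have c: "0 < c" using B by (simp add: c_def spectral_norm_pos)
  have M: "spectral_norm (B i) \<le> M" if "i \<le> 1" for i
    unfolding M_def using that by (rule Max_spectral_norm_ge)
  have M0: "0 \<le> M" using M[of 0] spectral_norm_nonneg[of "B 0"] by simp
  have V0: "0 \<le> V" and rs0: "0 \<le> r" "0 \<le> s" by (simp_all add: V_def r_def s_def)
  have N0: "0 \<le> N" "0 \<le> N'" "0 \<le> D" by (simp_all add: N_def D_def N'_def norm_inf_2 le_max_iff_disj)
  have "hmp_weight 1 (moebius_coeff 1 A B) w \<le>
      (norm (A$2$1) * r + norm (A$2$2) * s) * spectral_norm (B 0) +
      (norm (A$1$1) * r + norm (A$1$2) * s) * spectral_norm (B 1)"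
    using hmp_weight_moebius_le[of 1 A B w] by (simp add: r_def s_def)
  also have "\<dots> \<le> (norm (A$2$1) * r + norm (A$2$2) * s) * M + (norm (A$1$1) * r + norm (A$1$2) * s) * M"
    using rs0 by (intro add_mono mult_left_mono M) simp_all
  also have "\<dots> = M * ((norm (A$1$1) + norm (A$2$1)) * r + (norm (A$1$2) + norm (A$2$2)) * s)"
    by (simp add: algebra_simps)
  \<comment> \<open>Column sums of \<open>A\<close> are bounded by \<open>D * N'\<close>, which
    produces both the determinant and the norm of the inverse.\<close>
  also have "\<dots> \<le> M * ((D * N') * r + (D * N') * s)"
    using rs0 M0 unfolding D_def N'_def norm_det_norm_inf_inverse[OF inv]
    by (intro mult_left_mono add_mono mult_right_mono) simp_all
  finally have W: "hmp_weight 1 (moebius_coeff 1 A B) w \<le> M * (D * N') * (r + s)"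
    by (simp add: algebra_simps)
  have "(norm v)\<^sup>2 \<le> N * max_norm w * V"
    unfolding V_def N_def v_def
    by (rule order_trans[OF norm_sq_le_max_norm]) (intro mult_right_mono max_norm_mult_le, simp)
  then have "hmp_weight 1 (moebius_coeff 1 A B) w * (norm v)\<^sup>2 \<le> (M * (D * N') * (r + s)) * (N * max_norm w * V)"
    using M0 N0 rs0 by (intro mult_mono W) (auto intro!: mult_nonneg_nonneg)
  also have "\<dots> = M * (D * N') * N * V * ((r + s) * max_norm w)" by (simp add: mult_ac)
  also have "\<dots> \<le> M * (D * N') * N * V * (2 * (norm w)\<^sup>2)"
  proof (intro mult_left_mono)
    have "(r + s) * max_norm w \<le> (2 * max_norm w) * max_norm w"
      using max_norm_nonneg[of w] by (intro mult_right_mono) (auto simp: r_def s_def max_norm_def)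
    then show "(r + s) * max_norm w \<le> 2 * (norm w)\<^sup>2"
      using max_norm_sq_le[of w] by (simp add: power2_eq_square)
  qed (use M0 N0 V0 in \<open>auto intro!: mult_nonneg_nonneg\<close>)
  also have "\<dots> = 2 * (N * N' * (M / c) * (D * (norm w)\<^sup>2 * (c * V)))" using c by simp
  \<comment> \<open>The constant 2 obtained so far is enlarged to the 4 of the claim.\<close>
  also have "\<dots> \<le> 4 * (N * N' * (M / c) * (D * (norm w)\<^sup>2 * (c * V)))"
    using M0 N0 V0 c by (intro mult_right_mono mult_nonneg_nonneg) simp_all
  also have "\<dots> = 4 * N * (D * N') * (M / c) * (norm w)\<^sup>2 * (c * V)" by (simp add: mult_ac)
  also have "\<dots> \<le> 4 * N * (D * N') * (M / c) * (norm w)\<^sup>2 * hmp_weight 1 B v"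
  proof (rule mult_left_mono)
    show "c * V \<le> hmp_weight 1 B v" unfolding c_def V_def by (rule hmp_weight_1_ge)
    show "0 \<le> 4 * N * (D * N') * (M / c) * (norm w)\<^sup>2"
      using M0 N0 c by (intro mult_nonneg_nonneg) simp_all
  qed
  finally show ?thesis
    unfolding coeff_ratio_def M_def[symmetric] c_def[symmetric] v_def D_def N_def N'_def
    by (simp add: mult_ac)
qed

lemma hmp_weight_moebius_bound:
  fixes A :: "complex^2^2" and B :: "nat \<Rightarrow> complex^'n^'m"
  assumes k: "2 \<le> k" and inv: "A ** A' = mat 1" "A' ** A = mat 1" and B: "B 0 \<noteq> 0" "B k \<noteq> 0"
  shows "hmp_weight k (moebius_coeff k A B) w * (norm (A *v w))\<^sup>2 \<le>
    Z_const k * (norm_inf A * norm_inf A')^(k - 1) * coeff_ratio k B *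
      (norm (det A) * (norm w)\<^sup>2 * hmp_weight k B (A *v w))"
proof -
  define v where "v = A *v w"
  define M where "M = Max ((\<lambda>i. spectral_norm (B i)) ` {0..k})"
  define c where "c = min (spectral_norm (B 0)) (spectral_norm (B k))"
  define D where "D = norm (det A)"
  define N N' where "N = norm_inf A" and "N' = norm_inf A'"
  define m n where "m = max_norm w" and "n = max_norm v"
  define p q where "p = norm (A$1$1) * norm (w$1) + norm (A$1$2) * norm (w$2)"
    and "q = norm (A$2$1) * norm (w$1) + norm (A$2$2) * norm (w$2)"
  obtain j where j: "k = Suc (Suc j)" using k by (metis add_2_eq_Suc le_Suc_ex)
  have c: "0 < c" using B by (simp add: c_def spectral_norm_pos)
  have M: "spectral_norm (B i) \<le> M" if "i \<le> k" for i
    unfolding M_def using that by (rule Max_spectral_norm_ge)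
  have M0: "0 \<le> M" using M[of 0] spectral_norm_nonneg[of "B 0"] by simp
  have N0: "0 \<le> N" "0 \<le> N'" "0 \<le> D" by (simp_all add: N_def D_def N'_def norm_inf_2 le_max_iff_disj)
  have mn0: "0 \<le> m" "0 \<le> n" by (simp_all add: m_def n_def max_norm_nonneg)
  have pq0: "0 \<le> p" "0 \<le> q" by (simp_all add: p_def q_def)
  have row: "norm (A$i$1) * norm (w$1) + norm (A$i$2) * norm (w$2) \<le> N * m" for i
  proof -
    have "norm (A$i$1) * norm (w$1) + norm (A$i$2) * norm (w$2) \<le> norm (A$i$1) * m + norm (A$i$2) * m"
      by (intro add_mono mult_left_mono) (simp_all add: m_def max_norm_def)
    also have "\<dots> = (norm (A$i$1) + norm (A$i$2)) * m" by (simp add: algebra_simps)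
    also have "\<dots> \<le> N * m"
      using exhaust_2[of i] mn0 by (intro mult_right_mono) (auto simp: N_def norm_inf_2)
    finally show ?thesis .
  qed
  have "hmp_weight k (moebius_coeff k A B) w \<le> (\<Sum>i\<le>k. p^i * q^(k - i) * spectral_norm (B i))"
    unfolding p_def q_def by (rule hmp_weight_moebius_le)
  also have "\<dots> \<le> (\<Sum>i\<le>k. (N * m)^k * M)"
  proof (rule sum_mono)
    fix i assume i: "i \<in> {..k}"
    have "p^i * q^(k - i) \<le> (N * m)^i * (N * m)^(k - i)"
      using pq0 N0 mn0 row[of 1] row[of 2] by (intro mult_mono power_mono) (simp_all add: p_def q_def)
    also have "\<dots> = (N * m)^k" using i by (simp flip: power_add)
    finally show "p^i * q^(k - i) * spectral_norm (B i) \<le> (N * m)^k * M"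
      using i N0 mn0 by (intro mult_mono M spectral_norm_nonneg) simp_all
  qed
  finally have W: "hmp_weight k (moebius_coeff k A B) w \<le> (real k + 1) * M * (N * m)^k"
    by (simp add: algebra_simps)
  have "(norm v)\<^sup>2 \<le> 2 * n\<^sup>2"
  proof -
    have "max_norm v * (norm (v$1) + norm (v$2)) \<le> n * (2 * n)"
      unfolding n_def using max_norm_nonneg[of v] by (intro mult_left_mono) (auto simp: max_norm_def)
    then show ?thesis using norm_sq_le_max_norm[of v] by (simp add: power2_eq_square)
  qed
  then have "hmp_weight k (moebius_coeff k A B) w * (norm v)\<^sup>2 \<le> ((real k + 1) * M * (N * m)^k) * (2 * n\<^sup>2)"
    using M0 N0 mn0 by (intro mult_mono W) simp_all
  \<comment> \<open>One factor \<open>N\<close> and the power \<open>m^j\<close> are isolated.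
    Replacing \<open>N\<close> by \<open>2 * (D * N')\<close> and \<open>m\<close> by
    \<open>N' * n\<close> then yields the determinant, the power \<open>(N * N')^(k - 1)\<close>
    and, together with \<open>n^2\<close>, the full \<open>n^k\<close>.\<close>
  also have "\<dots> = 2 * (real k + 1) * M * N^(Suc j) * m\<^sup>2 * n\<^sup>2 * (N * m^j)"
    by (simp add: j power_mult_distrib power2_eq_square mult_ac)
  also have "\<dots> \<le> 2 * (real k + 1) * M * N^(Suc j) * m\<^sup>2 * n\<^sup>2 * ((2 * (D * N')) * (N' * n)^j)"
  proof (intro mult_left_mono mult_mono power_mono)
    show "N \<le> 2 * (D * N')" unfolding N_def D_def N'_def by (rule norm_inf_le_norm_det[OF inv(1)])
    have "w = A' *v v" by (simp add: v_def matrix_vector_mul_assoc inv(2))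
    then show "m \<le> N' * n" unfolding m_def n_def N'_def using max_norm_mult_le by metis
  qed (use M0 N0 mn0 in simp_all)
  also have "\<dots> = 4 * (real k + 1) * M * (N * N')^(Suc j) * D * n^k * m\<^sup>2"
    by (simp add: j power_mult_distrib power2_eq_square mult_ac)
  also have "\<dots> \<le> 4 * (real k + 1) * M * (N * N')^(Suc j) * D * n^k * (norm w)\<^sup>2"
    using M0 N0 mn0 unfolding m_def by (intro mult_left_mono max_norm_sq_le) simp_all
  also have "\<dots> = 4 * (real k + 1) * ((M / c) * (N * N')^(Suc j) * D * (norm w)\<^sup>2) * (c * n^k)"
    using c by (simp add: mult_ac)
  \<comment> \<open>The factor \<open>4 * (k + 1)\<close> combines the \<open>k + 1\<close>
    summands, the 2 from \<open>|v|^2\<close> and the 2 from the column sums; it is at most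
    \<open>Z_const k\<close> since the binomial coefficient is at least 1.\<close>
  also have "\<dots> \<le> Z_const k * ((M / c) * (N * N')^(Suc j) * D * (norm w)\<^sup>2) * hmp_weight k B v"
  proof (intro mult_mono)
    show "c * n^k \<le> hmp_weight k B v" unfolding c_def n_def using k by (intro hmp_weight_ge) simp
    have "1 \<le> k choose (k div 2)" using zero_less_binomial[of "k div 2" k] by (simp add: Suc_leI)
    then have "(real k + 1) * 1 \<le> (real k + 1)\<^sup>2 * real (k choose (k div 2))"
      by (intro mult_mono) (simp_all add: power2_eq_square)
    then show "4 * (real k + 1) \<le> Z_const k" by (simp add: Z_const_def)
  qed (use M0 N0 mn0 c in \<open>simp_all add: Z_const_def\<close>)
  finally show ?thesis
    unfolding coeff_ratio_def M_def[symmetric] c_def[symmetric] v_def D_def N_def N'_def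
    by (simp add: j mult_ac)
qed

section \<open>The bounds\<close>

lemma hmp_weight_pos:
  assumes "1 \<le> k" "v \<noteq> 0" "B 0 \<noteq> 0" "B k \<noteq> 0"
  shows "0 < hmp_weight k B v"
proof -
  have "0 < max_norm v" using assms(2) by (auto simp: max_norm_def vec_eq_iff forall_2 less_max_iff_disj)
  then have "0 < min (spectral_norm (B 0)) (spectral_norm (B k)) * max_norm v ^ k"
    using assms by (intro mult_pos_pos) (simp_all add: spectral_norm_pos)
  then show ?thesis using hmp_weight_ge[OF assms(1), of B v] by linarith
qed

text \<open>The second inequality bounds the reciprocal quotient, since the inverse matrix has
  determinant of modulus \<open>1 / D\<close>.\<close>

lemma ratio_bounds:
  fixes K :: real
  assumes pos: "0 < W" "0 < W'" "0 < D" "0 < a" "0 < b"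
    and upper: "W' * a \<le> K * \<rho> * (D * b * W)" and lower: "W * b \<le> K * \<rho>' * (1 / D * a * W')"
  shows "1 / (K * \<rho>') \<le> W' * a / (D * b * W) \<and> W' * a / (D * b * W) \<le> K * \<rho>"
proof
  have l: "D * b * W \<le> (K * \<rho>') * (W' * a)"
    using mult_left_mono[OF lower, of D] pos by (simp add: mult_ac)
  moreover have "0 < D * b * W" "0 < W' * a" using pos by simp_all
  \<comment> \<open>Positivity of the product of \<open>K\<close> and the ratio is read off from the
    inequality itself, so no sign conditions on them are assumed.\<close>
  ultimately have "0 < (K * \<rho>') * (W' * a)" by linarith
  then have "0 < K * \<rho>'" using \<open>0 < W' * a\<close> by (simp only: zero_less_mult_pos2)
  then show "1 / (K * \<rho>') \<le> W' * a / (D * b * W)"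
    using l \<open>0 < D * b * W\<close> by (simp add: divide_simps mult_ac)
  show "W' * a / (D * b * W) \<le> K * \<rho>"
    using upper \<open>0 < D * b * W\<close> by (simp add: pos_divide_le_eq)
qed

theorem theorem5p8:
  fixes B :: "nat \<Rightarrow> complex^'n^'n" and k :: nat
    and A :: "complex^2^2" and v :: "complex^2"
  assumes "hmp_regular k B"
    and "invertible A"
    and "v \<noteq> 0"
    and "simple_eigenvalue k B (line v)"
    and "B 0 \<noteq> 0" and "B k \<noteq> 0"
    and "moebius_coeff k A B 0 \<noteq> 0" and "moebius_coeff k A B k \<noteq> 0"
  shows "(k = 1 \<longrightarrow>
            1 / (4 * cond_inf A * coeff_ratio k (moebius_coeff k A B)) \<le> Q_theta_r k A B v \<and>
            Q_theta_r k A B v \<le> 4 * cond_inf A * coeff_ratio k B) \<and>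
         (k \<ge> 2 \<longrightarrow>
            1 / (Z_const k * cond_inf A ^ (k - 1) * coeff_ratio k (moebius_coeff k A B)) \<le> Q_theta_r k A B v \<and>
            Q_theta_r k A B v \<le> Z_const k * cond_inf A ^ (k - 1) * coeff_ratio k B)"
proof -
  define A' where "A' = matrix_inv A"
  define w where "w = A' *v v"
  define B' where "B' = moebius_coeff k A B"
  have inv: "A ** A' = mat 1" "A' ** A = mat 1"
    unfolding A'_def matrix_inv_def using assms(2) by (auto simp: invertible_def intro: someI2_ex)
  have v: "A *v w = v" by (simp add: w_def matrix_vector_mul_assoc inv(1))
  have "det A * det A' = 1" using inv(1) by (metis det_I det_mul)
  then have D: "det A \<noteq> 0" "norm (det A') = 1 / norm (det A)"
    by (auto simp: eq_divide_eq mult.commute simp flip: norm_mult)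
  have w0: "w \<noteq> 0" using assms(3) v by auto
  \<comment> \<open>Transforming back with the inverse restores the coefficients of
    \<open>P\<close>, so the reversed estimate involves the original weight.\<close>
  have weight: "hmp_weight k (moebius_coeff k A' B') v = hmp_weight k B v"
    unfolding hmp_weight_def B'_def by (intro sum.cong) (simp_all add: moebius_coeff_inverse inv(1))
  have Q: "Q_theta_r k A B v =
      hmp_weight k B' w * (norm v)\<^sup>2 / (norm (det A) * (norm w)\<^sup>2 * hmp_weight k B v)"
    using Q_theta_r_eq[of k B A w] assms(1,3,4) D unfolding v B'_def by (simp add: w_def A'_def)
  \<comment> \<open>Both cases share this reduction; only the constant \<open>K\<close> and the
    weight estimate differ.\<close>
  have bounds: "1 / (K * coeff_ratio k B') \<le> Q_theta_r k A B v \<and> Q_theta_r k A B v \<le> K * coeff_ratio k B"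
    if k: "1 \<le> k"
      and upper: "hmp_weight k B' w * (norm (A *v w))\<^sup>2 \<le>
        K * coeff_ratio k B * (norm (det A) * (norm w)\<^sup>2 * hmp_weight k B (A *v w))"
      and lower: "hmp_weight k (moebius_coeff k A' B') v * (norm (A' *v v))\<^sup>2 \<le>
        K * coeff_ratio k B' * (norm (det A') * (norm v)\<^sup>2 * hmp_weight k B' (A' *v v))" for K
    unfolding Q
  proof (rule ratio_bounds)
    show "0 < hmp_weight k B v" using k assms by (intro hmp_weight_pos)
    show "0 < hmp_weight k B' w" using k w0 assms(7,8) by (intro hmp_weight_pos) (simp_all add: B'_def)
    show "hmp_weight k B' w * (norm v)\<^sup>2 \<le> K * coeff_ratio k B * (norm (det A) * (norm w)\<^sup>2 * hmp_weight k B v)"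
      using upper by (simp add: v)
    show "hmp_weight k B v * (norm w)\<^sup>2 \<le> K * coeff_ratio k B' * (1 / norm (det A) * (norm v)\<^sup>2 * hmp_weight k B' w)"
      using lower by (simp add: weight D(2) flip: w_def)
  qed (use D w0 assms(3) in simp_all)
  \<comment> \<open>The second order of the factors is the one that appears when \<open>A\<close>
    and its inverse exchange roles.\<close>
  have cond: "cond_inf A = norm_inf A * norm_inf A'" "cond_inf A = norm_inf A' * norm_inf A"
    by (simp_all add: cond_inf_def A'_def)
  have "1 / (4 * cond_inf A * coeff_ratio k B') \<le> Q_theta_r k A B v \<and>
      Q_theta_r k A B v \<le> 4 * cond_inf A * coeff_ratio k B" if k: "k = 1"
  proof (rule bounds)
    show "hmp_weight k B' w * (norm (A *v w))\<^sup>2 \<le> 4 * cond_inf A * coeff_ratio k B *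
        (norm (det A) * (norm w)\<^sup>2 * hmp_weight k B (A *v w))"
      using assms(5,6) hmp_weight_moebius_bound_1[OF inv(1), of B w] unfolding cond(1) B'_def k by simp
    show "hmp_weight k (moebius_coeff k A' B') v * (norm (A' *v v))\<^sup>2 \<le> 4 * cond_inf A * coeff_ratio k B' *
        (norm (det A') * (norm v)\<^sup>2 * hmp_weight k B' (A' *v v))"
      using assms(7,8) hmp_weight_moebius_bound_1[OF inv(2), of B' v] unfolding cond(2) B'_def k by simp
  qed (use k in simp)
  moreover have "1 / (Z_const k * cond_inf A ^ (k - 1) * coeff_ratio k B') \<le> Q_theta_r k A B v \<and>
      Q_theta_r k A B v \<le> Z_const k * cond_inf A ^ (k - 1) * coeff_ratio k B" if k: "k \<ge> 2"
  proof (rule bounds)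
    show "hmp_weight k B' w * (norm (A *v w))\<^sup>2 \<le> Z_const k * cond_inf A ^ (k - 1) * coeff_ratio k B *
        (norm (det A) * (norm w)\<^sup>2 * hmp_weight k B (A *v w))"
      unfolding cond(1) B'_def using assms(5,6) by (rule hmp_weight_moebius_bound[OF k inv])
    show "hmp_weight k (moebius_coeff k A' B') v * (norm (A' *v v))\<^sup>2 \<le>
        Z_const k * cond_inf A ^ (k - 1) * coeff_ratio k B' * (norm (det A') * (norm v)\<^sup>2 * hmp_weight k B' (A' *v v))"
      unfolding cond(2) using assms(7,8)[folded B'_def] by (rule hmp_weight_moebius_bound[OF k inv(2,1)])
  qed (use k in simp)
  ultimately show ?thesis unfolding B'_def by blast
qed

end
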